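(* There is an absolute constant $C$ such that for every integer $N\ge2$ and real $\Delta>0$ there is a pair $(E,D)$, $E:\mathcal P([N])\times[N]\to\{0,1\}^*$, $D:\mathcal P([N])\times\{0,1\}^*\to[N]$, with $D(Q,E(P,m))=m$ for all $\Delta$-close $P,Q\in\mathcal P([N])$ and all $m\in[N]$ (zero error), such that: for every $P\in\mathcal F=\mathrm{Flat}_N\cup\mathrm{Geo}_N\cup\mathrm{Bin}_N$, $\mathbb E_{m\sim P}[|E(P,m)|]\le C\,2^{H(P)}\lceil\Delta\log^*N\rceil$; and moreover, for every $P\in\mathcal P([N])$ that is $(\Delta\log^*N)$-close to some $\tilde P\in\mathcal F$, $\mathbb E_{m\sim P}[|E(P,m)|]\le C\,2^{H(\tilde P)}\lceil\Delta\log^*N\rceil$.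
   Context: $\mathcal P([N])$ is the set of probability distributions on $[N]=\{1,\dots,N\}$; $\{0,1\}^*$ is the set of finite binary strings. $P,Q$ are $\Delta$-close if for all $m$, $\log_2(P(m)/Q(m))\le\Delta$ and $\log_2(Q(m)/P(m))\le\Delta$. $H(P)=\sum_mP(m)\log_2(1/P(m))$. $\log^*N$ is the least integer $i$ such that the $i$-fold iterated base-2 logarithm of $N$ is at most $1$. $\mathrm{Flat}_N$: distributions uniform on some subset of $[N]$. $\mathrm{Geo}_N$: distributions for which there are $\alpha\in(0,1)$ and a permutation $\pi$ of $[N]$ with $P(\pi(k+1))=\alpha P(\pi(k))$ for all $k\in[N-1]$. $\mathrm{Bin}_N$: distributions for which there are $p\in(0,1)$ and a bijection $\pi:\{0,\dots,N-1\}\to[N]$ with $P(\pi(k))=\binom{N-1}{k}p^k(1-p)^{N-1-k}$. *)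

theory Defs
  imports Complex_Main
begin

definition is_dist :: "nat \<Rightarrow> (nat \<Rightarrow> real) \<Rightarrow> bool" where
  "is_dist N P \<longleftrightarrow> (\<forall>m\<in>{1..N}. P m \<ge> 0) \<and> (\<forall>m. m \<notin> {1..N} \<longrightarrow> P m = 0)
     \<and> (\<Sum>m=1..N. P m) = 1"

text \<open>Delta-closeness: log2(P m / Q m) <= Delta and log2(Q m / P m) <= Delta for all m,
with the extended-real convention (so a zero on one side forces a zero on the other).\<close>
definition close :: "nat \<Rightarrow> real \<Rightarrow> (nat \<Rightarrow> real) \<Rightarrow> (nat \<Rightarrow> real) \<Rightarrow> bool" where
  "close N \<Delta> P Q \<longleftrightarrow> (\<forall>m\<in>{1..N}. P m \<le> 2 powr \<Delta> * Q m \<and> Q m \<le> 2 powr \<Delta> * P m)"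

definition entropy :: "nat \<Rightarrow> (nat \<Rightarrow> real) \<Rightarrow> real" where
  "entropy N P = (\<Sum>m\<in>{m\<in>{1..N}. P m > 0}. P m * log 2 (1 / P m))"

definition log_star :: "nat \<Rightarrow> nat" where
  "log_star N = (LEAST i. ((log 2) ^^ i) (real N) \<le> 1)"

definition Flat :: "nat \<Rightarrow> (nat \<Rightarrow> real) set" where
  "Flat N = {P. is_dist N P \<and> (\<exists>S. S \<subseteq> {1..N} \<and> S \<noteq> {} \<and>
      (\<forall>m\<in>{1..N}. P m = (if m \<in> S then 1 / real (card S) else 0)))}"

definition Geo :: "nat \<Rightarrow> (nat \<Rightarrow> real) set" where
  "Geo N = {P. is_dist N P \<and> (\<exists>\<alpha> \<pi>. 0 < \<alpha> \<and> \<alpha> < 1 \<and> bij_betw \<pi> {1..N} {1..N} \<and>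
      (\<forall>k\<in>{1..N-1}. P (\<pi> (k+1)) = \<alpha> * P (\<pi> k)))}"

definition Bin :: "nat \<Rightarrow> (nat \<Rightarrow> real) set" where
  "Bin N = {P. is_dist N P \<and> (\<exists>p \<pi>. 0 < p \<and> p < 1 \<and> bij_betw \<pi> {0..N-1} {1..N} \<and>
      (\<forall>k\<in>{0..N-1}. P (\<pi> k) = real ((N-1) choose k) * p ^ k * (1-p) ^ (N-1-k)))}"

definition Fam :: "nat \<Rightarrow> (nat \<Rightarrow> real) set" where
  "Fam N = Flat N \<union> Geo N \<union> Bin N"

definition exp_len :: "nat \<Rightarrow> (nat \<Rightarrow> real) \<Rightarrow> (nat \<Rightarrow> bool list) \<Rightarrow> real" where
  "exp_len N P c = (\<Sum>m=1..N. P m * real (length (c m)))"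

end

theory Submission
  imports Defs "HOL-Library.FuncSet"
begin

text \<open>
  Put \<open>K = log_star N\<close> and \<open>W = \<lceil>\<Delta> K\<rceil>\<close>.  To send \<open>m\<close>, the encoder rounds \<open>P m\<close> down to
  a threshold \<open>2 powr (- W j)\<close> and cuts \<open>[N]\<close> into levels of ratio \<open>2 powr (2 \<Delta>)\<close> below it.
  Two distributions that are \<open>\<Delta>\<close>-close to a common one have level functions differing by at
  most one everywhere, so it suffices to colour the pairs (message, level function) properly with
  respect to this relation.  A Linial-style colour reduction with cover-free families replaces
  \<open>n\<close> colours by \<open>O((D log n)\<^sup>2)\<close>, where \<open>D \<le> d 3^d\<close> and \<open>d\<close> is the number of messages in the
  first \<open>K\<close> levels: each of them has at most three possible levels at a neighbour.  Each round
  consumes one level, and after \<open>K\<close> rounds the colours fit into \<open>O(d)\<close> bits.  The codeword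
  consists of \<open>j\<close> and \<open>d\<close> in unary and the colour.

  Let \<open>Q\<close> be in one of the families and let \<open>M\<close> be its maximum.  At most \<open>5 (1 + u) / M\<close> points
  have \<open>Q\<close>-probability at least \<open>M * 2 powr (- u)\<close>; for Geo and Bin this is because they are
  log-concave after reordering.  If \<open>P\<close> is \<open>W\<close>-close to \<open>Q\<close> and \<open>t m = log (M / Q m)\<close>, then
  \<open>d = O((W + t m) / M)\<close>.  Averaging \<open>t / 2 \<le> W + 2 * 2 powr (t / 2 - W)\<close> over
  \<open>P m \<le> 2 powr W * M * 2 powr (- t m)\<close> shows \<open>E t = O(W)\<close>, and \<open>1 / M \<le> 2 powr H(Q)\<close>.
\<close>

section \<open>Cover-free families\<close>

lemma card_PiE_fixed_le:
  assumes "finite I" "finite A" "S \<subseteq> I"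
  shows "card {v \<in> I \<rightarrow>\<^sub>E A. \<forall>i\<in>S. v i = u i} \<le> card A ^ (card I - card S)"
proof -
  let ?fixed = "{v \<in> I \<rightarrow>\<^sub>E A. \<forall>i\<in>S. v i = u i}"
  let ?forget = "\<lambda>v. restrict v (I - S)"
  have "inj_on ?forget ?fixed"
  proof (rule inj_onI)
    fix v w assume v: "v \<in> ?fixed" and w: "w \<in> ?fixed" and eq: "?forget v = ?forget w"
    show "v = w"
    proof (rule PiE_ext[where k = I and s = "\<lambda>_. A"])
      show "v i = w i" if "i \<in> I" for i
        using that v w fun_cong[OF eq, of i] by (cases "i \<in> S") auto
    qed (use v w in auto)
  qed
  moreover have "?forget ` ?fixed \<subseteq> (I - S) \<rightarrow>\<^sub>E A" by (auto simp: PiE_def Pi_def)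
  ultimately have "card ?fixed \<le> card ((I - S) \<rightarrow>\<^sub>E A)"
    by (rule card_inj_on_le) (simp add: assms finite_PiE)
  also have "\<dots> = card A ^ (card I - card S)"
    using assms by (simp add: card_funcsetE card_Diff_subset finite_subset)
  finally show ?thesis .
qed

lemma card_PiE_agreeing_le:
  assumes "finite I" "finite A"
  shows "card {v \<in> I \<rightarrow>\<^sub>E A. s \<le> card {i \<in> I. v i = u i}}
    \<le> (card I choose s) * card A ^ (card I - s)"
proof -
  let ?subsets = "{S. S \<subseteq> I \<and> card S = s}"
  let ?fixed = "\<lambda>S. {v \<in> I \<rightarrow>\<^sub>E A. \<forall>i\<in>S. v i = u i}"
  have finite_subsets: "finite ?subsets" using assms(1) by simp
  have "{v \<in> I \<rightarrow>\<^sub>E A. s \<le> card {i \<in> I. v i = u i}} \<subseteq> (\<Union>S\<in>?subsets. ?fixed S)"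
  proof
    fix v assume v: "v \<in> {v \<in> I \<rightarrow>\<^sub>E A. s \<le> card {i \<in> I. v i = u i}}"
    then obtain S where "S \<subseteq> {i \<in> I. v i = u i}" "card S = s"
      using obtain_subset_with_card_n by (metis (no_types, lifting) mem_Collect_eq)
    with v show "v \<in> (\<Union>S\<in>?subsets. ?fixed S)" by auto
  qed
  then have "card {v \<in> I \<rightarrow>\<^sub>E A. s \<le> card {i \<in> I. v i = u i}} \<le> card (\<Union>S\<in>?subsets. ?fixed S)"
    using finite_subsets by (intro card_mono) (auto simp: assms finite_PiE)
  also have "\<dots> \<le> (\<Sum>S\<in>?subsets. card (?fixed S))" by (rule card_UN_le[OF finite_subsets])
  also have "\<dots> \<le> (\<Sum>S\<in>?subsets. card A ^ (card I - s))"
    using card_PiE_fixed_le[OF assms] by (intro sum_mono) auto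
  also have "\<dots> = (card I choose s) * card A ^ (card I - s)" using n_subsets[OF assms(1)] by simp
  finally show ?thesis .
qed

text \<open>The Gilbert--Varshamov argument: words are chosen greedily.\<close>

lemma code_with_few_agreements:
  assumes "finite I" "finite A" "A \<noteq> {}" "s \<le> card I" "n * (card I choose s) \<le> card A ^ s"
  shows "\<exists>w. (\<forall>a<n. w a \<in> I \<rightarrow>\<^sub>E A) \<and> (\<forall>a<n. \<forall>b<n. a \<noteq> b \<longrightarrow> card {i \<in> I. w a i = w b i} < s)"
  using assms(5)
proof (induction n)
  case (Suc n)
  then obtain w :: "nat \<Rightarrow> 'a \<Rightarrow> 'b" where words: "\<forall>a<n. w a \<in> I \<rightarrow>\<^sub>E A"
    and apart: "\<forall>a<n. \<forall>b<n. a \<noteq> b \<longrightarrow> card {i \<in> I. w a i = w b i} < s"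
    by auto
  let ?excluded = "\<lambda>a. {v \<in> I \<rightarrow>\<^sub>E A. s \<le> card {i \<in> I. v i = w a i}}"
  have "card (\<Union>a<n. ?excluded a) \<le> (\<Sum>a<n. card (?excluded a))" by (rule card_UN_le) simp
  also have "\<dots> \<le> (\<Sum>a<n. (card I choose s) * card A ^ (card I - s))"
    by (intro sum_mono card_PiE_agreeing_le assms)
  also have "\<dots> < Suc n * (card I choose s) * card A ^ (card I - s)"
    using assms by (simp add: card_gt_0_iff)
  also have "\<dots> \<le> card A ^ s * card A ^ (card I - s)"
    using Suc.prems by (rule mult_right_mono) simp
  also have "\<dots> = card (I \<rightarrow>\<^sub>E A)" using assms by (simp add: card_funcsetE flip: power_add)
  finally have "\<not> (I \<rightarrow>\<^sub>E A) \<subseteq> (\<Union>a<n. ?excluded a)"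
    using card_mono[of "\<Union>a<n. ?excluded a" "I \<rightarrow>\<^sub>E A"] by (auto simp: finite_PiE assms)
  then obtain v where v: "v \<in> I \<rightarrow>\<^sub>E A" and "v \<notin> (\<Union>a<n. ?excluded a)" by blast
  then have v_apart: "\<forall>a<n. card {i \<in> I. v i = w a i} < s" by (auto simp: not_le)
  then have "\<forall>a<n. card {i \<in> I. w a i = v i} < s" by (simp add: eq_commute)
  with v v_apart words apart show ?case
    by (intro exI[of _ "w(n := v)"]) (auto simp: less_Suc_eq)
qed auto

definition cover_free :: "nat \<Rightarrow> 'a set \<Rightarrow> ('a \<Rightarrow> 'b set) \<Rightarrow> bool" where
  "cover_free D A F \<longleftrightarrow>
     (\<forall>a\<in>A. \<forall>B\<subseteq>A. finite B \<and> card B \<le> D \<and> a \<notin> B \<longrightarrow> \<not> F a \<subseteq> (\<Union>b\<in>B. F b))"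

lemma cover_free_graphs:
  assumes "finite I" "D * (s - 1) < card I"
    and agree: "\<And>a b. \<lbrakk>a \<in> A; b \<in> A; a \<noteq> b\<rbrakk> \<Longrightarrow> card {i \<in> I. w a i = w b i} < s"
  shows "cover_free D A (\<lambda>a. (\<lambda>i. (i, w a i)) ` I)"
  unfolding cover_free_def
proof (intro ballI allI impI notI; elim conjE)
  fix a B assume "a \<in> A" "B \<subseteq> A" and B: "finite B" "card B \<le> D" and "a \<notin> B"
    and "(\<lambda>i. (i, w a i)) ` I \<subseteq> (\<Union>b\<in>B. (\<lambda>i. (i, w b i)) ` I)"
  then have "I \<subseteq> (\<Union>b\<in>B. {i \<in> I. w a i = w b i})" by auto
  then have "card I \<le> card (\<Union>b\<in>B. {i \<in> I. w a i = w b i})"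
    using assms(1) B(1) by (intro card_mono) auto
  also have "\<dots> \<le> (\<Sum>b\<in>B. card {i \<in> I. w a i = w b i})" by (rule card_UN_le[OF B(1)])
  also have "\<dots> \<le> of_nat (card B) * (s - 1)"
  proof (rule sum_bounded_above)
    fix b assume "b \<in> B"
    then have "card {i \<in> I. w a i = w b i} < s"
      using agree[of a b] \<open>a \<in> A\<close> \<open>B \<subseteq> A\<close> \<open>a \<notin> B\<close> by auto
    then show "card {i \<in> I. w a i = w b i} \<le> s - 1" by simp
  qed
  also have "\<dots> \<le> D * (s - 1)" using B(2) by simp
  finally show False using assms(2) by simp
qed

lemma cover_free_inj_image:
  assumes "cover_free D A F" and inj: "inj_on h (\<Union>a\<in>A. F a)"
  shows "cover_free D A (\<lambda>a. h ` F a)"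
  unfolding cover_free_def
proof (intro ballI allI impI notI)
  fix a B assume a: "a \<in> A" and B: "B \<subseteq> A" "finite B \<and> card B \<le> D \<and> a \<notin> B"
    and "h ` F a \<subseteq> (\<Union>b\<in>B. h ` F b)"
  then have "h ` F a \<subseteq> h ` (\<Union>b\<in>B. F b)" by (simp add: image_UN)
  then have "F a \<subseteq> (\<Union>b\<in>B. F b)" using inj a B(1) unfolding inj_on_def by blast
  with assms(1) a B show False by (auto simp: cover_free_def)
qed

lemma cover_free_family_exists:
  assumes "1 \<le> s" "1 \<le> D"
  shows "\<exists>F :: nat \<Rightarrow> nat set.
    cover_free D {..<2 ^ s} F \<and> (\<forall>a<2 ^ s. F a \<subseteq> {..<2 * D\<^sup>2 * s\<^sup>2})"
proof -
  define t where "t = D * s"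
  have t_bounds: "s \<le> t" "0 < t" using assms by (auto simp: t_def)
  have "2 ^ s * (t choose s) \<le> 2 ^ s * t ^ s" using binomial_le_pow[OF t_bounds(1)] by simp
  then have "2 ^ s * (t choose s) \<le> (2 * t) ^ s" by (simp add: power_mult_distrib)
  then obtain w :: "nat \<Rightarrow> nat \<Rightarrow> nat" where words: "\<forall>a<2 ^ s. w a \<in> {..<t} \<rightarrow>\<^sub>E {..<2 * t}"
    and apart: "\<forall>a<2 ^ s. \<forall>b<2 ^ s. a \<noteq> b \<longrightarrow> card {i \<in> {..<t}. w a i = w b i} < s"
    using code_with_few_agreements[of "{..<t}" "{..<2 * t}" s "2 ^ s"] t_bounds
    by (auto simp: lessThan_empty_iff)
  obtain h :: "nat \<times> nat \<Rightarrow> nat" where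
    bij_h: "bij_betw h ({..<t} \<times> {..<2 * t}) {0..<card ({..<t} \<times> {..<2 * t})}"
    using ex_bij_betw_finite_nat[of "{..<t} \<times> {..<2 * t}"] by blast
  define graph where "graph a = (\<lambda>i. (i, w a i)) ` {..<t}" for a
  have graph_subset: "graph a \<subseteq> {..<t} \<times> {..<2 * t}" if "a < 2 ^ s" for a
    using words that by (fastforce simp: graph_def)
  have "D * (s - 1) < t" using assms by (simp add: t_def)
  then have "cover_free D {..<2 ^ s} graph"
    unfolding graph_def using apart by (intro cover_free_graphs[where s = s]) auto
  moreover have "inj_on h (\<Union>a\<in>{..<2 ^ s}. graph a)"
    by (rule inj_on_subset[OF bij_betw_imp_inj_on[OF bij_h]]) (use graph_subset in auto)
  ultimately have "cover_free D {..<2 ^ s} (\<lambda>a. h ` graph a)" by (rule cover_free_inj_image)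
  moreover have "h ` graph a \<subseteq> {..<2 * D\<^sup>2 * s\<^sup>2}" if "a < 2 ^ s" for a
  proof -
    have "h ` graph a \<subseteq> {0..<card ({..<t} \<times> {..<2 * t})}"
      using graph_subset[OF that] bij_betw_imp_surj_on[OF bij_h] by blast
    also have "\<dots> = {..<2 * D\<^sup>2 * s\<^sup>2}"
      by (simp add: t_def power2_eq_square atLeast0LessThan mult_ac)
    finally show ?thesis .
  qed
  ultimately show ?thesis by blast
qed

section \<open>Colour reduction\<close>

definition proper_colouring :: "'v set \<Rightarrow> ('v \<Rightarrow> 'v \<Rightarrow> bool) \<Rightarrow> 'c set \<Rightarrow> ('v \<Rightarrow> 'c) \<Rightarrow> bool" where
  "proper_colouring V adj C c \<longleftrightarrow> c \<in> V \<rightarrow> C \<and> (\<forall>u\<in>V. \<forall>v\<in>V. adj u v \<longrightarrow> c u \<noteq> c v)"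

lemma proper_colouring_mono:
  assumes "proper_colouring V adj C c" "C \<subseteq> C'"
  shows "proper_colouring V adj C' c"
  using assms by (auto simp: proper_colouring_def Pi_iff)

lemma proper_colouring_comp:
  assumes "proper_colouring V' adj' C c" "h \<in> V \<rightarrow> V'"
    and "\<And>u v. \<lbrakk>u \<in> V; v \<in> V; adj u v\<rbrakk> \<Longrightarrow> adj' (h u) (h v)"
  shows "proper_colouring V adj C (c \<circ> h)"
  using assms by (auto simp: proper_colouring_def Pi_iff)

text \<open>Linial's colour reduction: a vertex picks an element of its set that no neighbour has.\<close>

lemma proper_colouring_cover_free:
  assumes proper: "proper_colouring V adj C c" and cover_free: "cover_free D C F"
    and degree: "\<And>v. v \<in> V \<Longrightarrow> finite (c ` {u \<in> V. adj v u}) \<and> card (c ` {u \<in> V. adj v u}) \<le> D"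
  shows "\<exists>c'. proper_colouring V adj (\<Union>a\<in>C. F a) c'"
proof -
  have "\<exists>y. y \<in> F (c v) \<and> (\<forall>u\<in>V. adj v u \<longrightarrow> y \<notin> F (c u))" if v: "v \<in> V" for v
  proof -
    have "c ` {u \<in> V. adj v u} \<subseteq> C" "c v \<in> C" "c v \<notin> c ` {u \<in> V. adj v u}"
      using proper v by (auto simp: proper_colouring_def Pi_iff)
    with cover_free degree[OF v] have "\<not> F (c v) \<subseteq> (\<Union>b\<in>c ` {u \<in> V. adj v u}. F b)"
      unfolding cover_free_def by blast
    then show ?thesis by blast
  qed
  then obtain c' where "\<And>v. v \<in> V \<Longrightarrow> c' v \<in> F (c v) \<and> (\<forall>u\<in>V. adj v u \<longrightarrow> c' v \<notin> F (c u))"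
    by metis
  with proper show ?thesis
    unfolding proper_colouring_def Pi_iff by (intro exI[of _ c']) (metis UN_I)
qed

lemma proper_colouring_fewer_bits:
  fixes c :: "'v \<Rightarrow> nat"
  assumes proper: "proper_colouring V adj {..<2 ^ s} c" and "1 \<le> s" "1 \<le> D"
    and degree: "\<And>v. v \<in> V \<Longrightarrow> finite (c ` {u \<in> V. adj v u}) \<and> card (c ` {u \<in> V. adj v u}) \<le> D"
    and fits: "2 * D\<^sup>2 * s\<^sup>2 \<le> 2 ^ s'"
  shows "\<exists>c' :: 'v \<Rightarrow> nat. proper_colouring V adj {..<2 ^ s'} c'"
proof -
  obtain F :: "nat \<Rightarrow> nat set" where cover_free: "cover_free D {..<2 ^ s} F"
    and bounded: "\<forall>a<2 ^ s. F a \<subseteq> {..<2 * D\<^sup>2 * s\<^sup>2}"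
    using cover_free_family_exists[OF assms(2,3)] by blast
  obtain c' where "proper_colouring V adj (\<Union>a\<in>{..<2 ^ s}. F a) c'"
    using proper_colouring_cover_free[OF proper cover_free degree] by blast
  moreover have "(\<Union>a\<in>{..<2 ^ s}. F a) \<subseteq> {..<2 ^ s'}" using bounded fits by fastforce
  ultimately have "proper_colouring V adj {..<2 ^ s'} c'" by (rule proper_colouring_mono)
  then show ?thesis by blast
qed

section \<open>The iterated logarithm\<close>

lemma log2_le_linear:
  assumes "0 < x"
  shows "log 2 x \<le> real k + 2 * x / 2 ^ k"
proof -
  have "1 / 2 \<le> ln (2::real)" using ln_le_minus_one[of "1 / 2 :: real"] by (simp add: ln_div)
  have "ln (x / 2 ^ k) \<le> x / 2 ^ k" using ln_le_minus_one[of "x / 2 ^ k"] assms by simp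
  also have "\<dots> \<le> (2 * x / 2 ^ k) * ln 2"
    using mult_left_mono[OF \<open>1 / 2 \<le> ln 2\<close>, of "2 * x / 2 ^ k"] assms by simp
  finally have "log 2 (x / 2 ^ k) \<le> 2 * x / 2 ^ k" by (simp add: log_def pos_divide_le_eq)
  moreover have "log 2 (x / 2 ^ k) = log 2 x - real k"
    using assms by (simp add: log_divide log_nat_power)
  ultimately show ?thesis by simp
qed

lemma nat_le_two_power_if_log2_le:
  fixes n :: nat
  assumes "log 2 (real n) \<le> real s"
  shows "n \<le> 2 ^ s"
proof (cases "n = 0")
  case False
  then have "real n \<le> 2 powr real s" using assms by (simp add: log_le_iff)
  then have "real n \<le> real (2 ^ s)" by (simp add: powr_realpow)
  then show ?thesis by (simp only: of_nat_le_iff)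
qed simp

definition iterated_log2 :: "nat \<Rightarrow> real \<Rightarrow> real" where
  "iterated_log2 k x = ((\<lambda>y. max 1 (log 2 y)) ^^ k) x"

lemma iterated_log2_Suc: "iterated_log2 (Suc k) x = max 1 (log 2 (iterated_log2 k x))"
  by (simp add: iterated_log2_def)

lemma iterated_log_le_one_exists:
  assumes "x \<le> real n + 1"
  shows "\<exists>i. (log 2 ^^ i) x \<le> 1"
  using assms
proof (induction n arbitrary: x)
  case 0
  then show ?case by (intro exI[of _ 0]) simp
next
  case (Suc n)
  show ?case
  proof (cases "x \<le> 0")
    case True
    then show ?thesis by (intro exI[of _ 0]) simp
  next
    case False
    have "n + 2 \<le> 2 ^ (n + 1)" by (induction n) auto
    then have "real (n + 2) \<le> real (2 ^ (n + 1))" by (simp only: of_nat_le_iff)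
    then have "x \<le> 2 powr (real n + 1)" using Suc.prems by (simp add: powr_add powr_realpow)
    then have "log 2 x \<le> real n + 1" using False by (simp add: log_le_iff)
    then obtain i where "(log 2 ^^ i) (log 2 x) \<le> 1" using Suc.IH by blast
    then show ?thesis by (intro exI[of _ "Suc i"]) (simp add: funpow_swap1)
  qed
qed

lemma iterated_log_log_star_le_one: "(log 2 ^^ log_star N) (real N) \<le> 1"
  unfolding log_star_def by (rule LeastI_ex[OF iterated_log_le_one_exists[of _ N]]) simp

lemma log_star_pos:
  assumes "2 \<le> N"
  shows "0 < log_star N"
  using iterated_log_log_star_le_one[of N] assms by (cases "log_star N") auto

lemma iterated_log2_log_star:
  assumes "1 \<le> N"
  shows "iterated_log2 (log_star N) (real N) = 1"
proof -
  have "iterated_log2 i (real N) = max 1 ((log 2 ^^ i) (real N))" if "i \<le> log_star N" for i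
    using that
  proof (induction i)
    case 0
    then show ?case using assms by (simp add: iterated_log2_def)
  next
    case (Suc i)
    then have "(log 2 ^^ i) (real N) > 1"
      using not_less_Least[of i "\<lambda>i. (log 2 ^^ i) (real N) \<le> 1"] by (simp add: log_star_def)
    with Suc show ?case by (simp add: iterated_log2_Suc)
  qed
  then show ?thesis using iterated_log_log_star_le_one[of N] by simp
qed

section \<open>Colouring level functions\<close>

definition levels_close :: "('a \<Rightarrow> nat) \<Rightarrow> ('a \<Rightarrow> nat) \<Rightarrow> bool" where
  "levels_close l l' \<longleftrightarrow> (\<forall>x. l x \<le> l' x + 1 \<and> l' x \<le> l x + 1)"

text \<open>A message on level \<open>0\<close> together with the level function that its encoder sees.  The
  parameter \<open>i\<close> counts the colour reduction rounds, each of which looks one level further.\<close>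

definition level_vertices :: "'a set \<Rightarrow> nat \<Rightarrow> nat \<Rightarrow> ('a \<times> ('a \<Rightarrow> nat)) set" where
  "level_vertices A d i = {(m, l). l m = 0 \<and> {x. l x \<le> i} \<subseteq> A \<and> card {x. l x \<le> i} \<le> d}"

fun level_adj :: "'a \<times> ('a \<Rightarrow> nat) \<Rightarrow> 'a \<times> ('a \<Rightarrow> nat) \<Rightarrow> bool" where
  "level_adj (m, l) (m', l') \<longleftrightarrow> m \<noteq> m' \<and> levels_close l l'"

definition truncate :: "nat \<Rightarrow> ('a \<Rightarrow> nat) \<Rightarrow> 'a \<Rightarrow> nat" where
  "truncate k l = (\<lambda>x. min (l x) k)"

lemma truncate_level_vertices:
  assumes "finite A"
  shows "apsnd (truncate (Suc i)) \<in> level_vertices A d (Suc i) \<rightarrow> level_vertices A d i"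
proof
  fix v assume "v \<in> level_vertices A d (Suc i)"
  then obtain m l where v: "v = (m, l)" "l m = 0"
    and ball: "{x. l x \<le> Suc i} \<subseteq> A" "card {x. l x \<le> Suc i} \<le> d"
    by (auto simp: level_vertices_def)
  have "card {x. l x \<le> i} \<le> card {x. l x \<le> Suc i}"
    using ball(1) assms by (intro card_mono) (auto intro: finite_subset)
  moreover have "{x. truncate (Suc i) l x \<le> i} = {x. l x \<le> i}" by (auto simp: truncate_def)
  ultimately show "apsnd (truncate (Suc i)) v \<in> level_vertices A d i"
    using v ball by (auto simp: level_vertices_def truncate_def)
qed

lemma levels_close_truncate:
  assumes "levels_close l l'"
  shows "levels_close (truncate k l) (truncate k l')"
  unfolding levels_close_def truncate_def
proof
  fix x
  have "l x \<le> l' x + 1 \<and> l' x \<le> l x + 1" using assms by (simp add: levels_close_def)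
  then show "min (l x) k \<le> min (l' x) k + 1 \<and> min (l' x) k \<le> min (l x) k + 1" by linarith
qed

lemma level_adj_truncate:
  "level_adj u v \<Longrightarrow> level_adj (apsnd (truncate k) u) (apsnd (truncate k) v)"
  by (cases u; cases v) (simp add: levels_close_truncate)

lemma card_truncated_close:
  fixes l :: "'a \<Rightarrow> nat"
  assumes "finite {x. l x \<le> k}"
  shows "finite (truncate k ` {l'. levels_close l l'})"
    and "card (truncate k ` {l'. levels_close l l'}) \<le> 3 ^ card {x. l x \<le> k}"
proof -
  let ?ball = "{x. l x \<le> k}"
  let ?choices = "\<Pi>\<^sub>E x\<in>?ball. {l x - 1..l x + 1}"
  let ?extend = "\<lambda>f x. if x \<in> ?ball then min (f x) k else k"
  have finite_choices: "finite ?choices" by (intro finite_PiE assms) auto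
  have subset: "truncate k ` {l'. levels_close l l'} \<subseteq> ?extend ` ?choices"
  proof
    fix g assume "g \<in> truncate k ` {l'. levels_close l l'}"
    then obtain l' where g: "g = truncate k l'" and "levels_close l l'" by auto
    then have close: "l x \<le> l' x + 1" "l' x \<le> l x + 1" for x by (auto simp: levels_close_def)
    then have "restrict l' ?ball \<in> ?choices" by (auto simp: le_diff_conv)
    moreover have "g = ?extend (restrict l' ?ball)"
    proof
      fix x show "g x = ?extend (restrict l' ?ball) x"
        using close(1)[of x] by (auto simp: g truncate_def min_def)
    qed
    ultimately show "g \<in> ?extend ` ?choices" by blast
  qed
  then show "finite (truncate k ` {l'. levels_close l l'})"
    using finite_choices finite_surj by blast
  have "card (truncate k ` {l'. levels_close l l'}) \<le> card ?choices"
    using finite_choices subset by (rule surj_card_le)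
  also have "\<dots> = (\<Prod>x\<in>?ball. card {l x - 1..l x + 1})" by (rule card_PiE[OF assms])
  also have "\<dots> \<le> (\<Prod>x\<in>?ball. 3)" by (rule prod_mono) auto
  finally show "card (truncate k ` {l'. levels_close l l'}) \<le> 3 ^ card ?ball" by simp
qed

lemma card_truncated_neighbours:
  assumes "finite A" and v: "v \<in> level_vertices A d (Suc i)"
  defines "nbrs \<equiv> {u \<in> level_vertices A d (Suc i). level_adj v u}"
  shows "finite (apsnd (truncate (Suc i)) ` nbrs)"
    and "card (apsnd (truncate (Suc i)) ` nbrs) \<le> 8 ^ d"
proof -
  obtain m l where "v = (m, l)"
    and ball: "{x. l x \<le> Suc i} \<subseteq> A" "card {x. l x \<le> Suc i} \<le> d"
    using v by (auto simp: level_vertices_def)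
  let ?ball = "{x. l x \<le> Suc i}"
  let ?near = "truncate (Suc i) ` {l'. levels_close l l'}"
  have finite_ball: "finite ?ball" using ball(1) assms(1) by (rule finite_subset)
  note near = card_truncated_close[OF finite_ball]
  have "apsnd (truncate (Suc i)) ` nbrs \<subseteq> ?ball \<times> ?near"
  proof (intro image_subsetI)
    fix u assume "u \<in> nbrs"
    then obtain m' l' where u: "u = (m', l')" "l' m' = 0" and close: "levels_close l l'"
      using \<open>v = (m, l)\<close> by (auto simp: nbrs_def level_vertices_def)
    then have "l m' \<le> l' m' + 1" unfolding levels_close_def by blast
    with u close show "apsnd (truncate (Suc i)) u \<in> ?ball \<times> ?near" by auto
  qed
  moreover have finite_prod: "finite (?ball \<times> ?near)" using finite_ball near(1) by blast
  ultimately show "finite (apsnd (truncate (Suc i)) ` nbrs)" by (rule finite_subset)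
  have "card (apsnd (truncate (Suc i)) ` nbrs) \<le> card ?ball * card ?near"
    using card_mono[OF finite_prod] \<open>_ \<subseteq> ?ball \<times> ?near\<close> by (simp add: card_cartesian_product)
  also have "\<dots> \<le> d * 3 ^ d"
    using ball(2) near(2) by (intro mult_mono) (auto intro: order_trans power_increasing)
  also have "\<dots> \<le> 2 ^ d * 4 ^ d" by (intro mult_mono power_mono) (auto simp: less_imp_le)
  also have "\<dots> = 8 ^ d" by (simp flip: power_mult_distrib)
  finally show "card (apsnd (truncate (Suc i)) ` nbrs) \<le> 8 ^ d" .
qed

lemma level_colouring_Suc:
  fixes c :: "'a \<times> ('a \<Rightarrow> nat) \<Rightarrow> nat"
  assumes "finite A" and proper: "proper_colouring (level_vertices A d i) level_adj {..<2 ^ s} c"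
    and "1 \<le> s" "2 * (8 ^ d)\<^sup>2 * s\<^sup>2 \<le> (2::nat) ^ s'"
  shows "\<exists>c' :: _ \<Rightarrow> nat. proper_colouring (level_vertices A d (Suc i)) level_adj {..<2 ^ s'} c'"
proof (rule proper_colouring_fewer_bits[OF _ assms(3) _ _ assms(4)])
  let ?trunc = "apsnd (truncate (Suc i))"
  show "proper_colouring (level_vertices A d (Suc i)) level_adj {..<2 ^ s} (c \<circ> ?trunc)"
    by (intro proper_colouring_comp[OF proper] truncate_level_vertices level_adj_truncate assms(1))
  show "finite ((c \<circ> ?trunc) ` {u \<in> level_vertices A d (Suc i). level_adj v u}) \<and>
      card ((c \<circ> ?trunc) ` {u \<in> level_vertices A d (Suc i). level_adj v u}) \<le> 8 ^ d"
    if "v \<in> level_vertices A d (Suc i)" for v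
    using card_truncated_neighbours[OF assms(1) that]
    unfolding image_comp[symmetric] by (meson card_image_le finite_imageI order_trans)
qed simp

lemma fewer_bits_exists:
  fixes s d :: nat
  assumes s_bounds: "1 \<le> s" "real s \<le> (12 * real d + 20) * L" and L_ge_one: "1 \<le> L"
  shows "\<exists>s'. 1 \<le> s' \<and> real s' \<le> (12 * real d + 20) * max 1 (log 2 L) \<and>
    2 * (8 ^ d)\<^sup>2 * s\<^sup>2 \<le> (2::nat) ^ s'"
proof -
  define K where "K = 12 * real d + 20"
  define s' where "s' = nat \<lceil>1 + 6 * real d + 2 * log 2 s\<rceil>"
  have "20 \<le> K" by (simp add: K_def)
  have log_s: "0 \<le> log 2 s" using s_bounds(1) by simp
  have s'_ge: "1 + 6 * real d + 2 * log 2 s \<le> real s'"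
    unfolding s'_def by (rule real_nat_ceiling_ge)
  have "log 2 s \<le> log 2 (K * L)" using s_bounds L_ge_one \<open>20 \<le> K\<close> by (simp add: K_def)
  also have "\<dots> = log 2 K + log 2 L" using L_ge_one \<open>20 \<le> K\<close> by (simp add: log_mult)
  also have "\<dots> \<le> 3 + K / 4 + log 2 L" using log2_le_linear[of K 3] \<open>20 \<le> K\<close> by simp
  finally have log_s_le: "log 2 s \<le> 3 + K / 4 + log 2 L" .
  have "real s' \<le> 2 + 6 * real d + 2 * log 2 s" using log_s unfolding s'_def by linarith
  also have "\<dots> \<le> 8 + 6 * real d + K / 2 + 2 * log 2 L" using log_s_le by simp
  also have "\<dots> = (K - 2) + 2 * log 2 L" by (simp add: K_def)
  also have "\<dots> \<le> (K - 2) * max 1 (log 2 L) + 2 * max 1 (log 2 L)"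
    using \<open>20 \<le> K\<close> by (intro add_mono) (simp_all add: mult_le_cancel_left1)
  also have "\<dots> = K * max 1 (log 2 L)" by (simp only: left_diff_distrib diff_add_cancel)
  finally have "real s' \<le> K * max 1 (log 2 L)" .
  moreover have "1 \<le> s'" using s'_ge log_s by linarith
  moreover have "2 * (8 ^ d)\<^sup>2 * s\<^sup>2 \<le> (2::nat) ^ s'"
  proof (rule nat_le_two_power_if_log2_le)
    have "log 2 8 = (3::real)" using log_nat_power[of 2 2 3] by simp
    then show "log 2 (real (2 * (8 ^ d)\<^sup>2 * s\<^sup>2)) \<le> real s'"
      using s_bounds(1) s'_ge by (simp add: log_mult log_nat_power power_mult_distrib)
  qed
  ultimately show ?thesis unfolding K_def by blast
qed

lemma level_colouring_iterate:
  assumes "finite A" "2 \<le> card A"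
  shows "\<exists>s (c :: 'a \<times> ('a \<Rightarrow> nat) \<Rightarrow> nat). 1 \<le> s \<and>
    real s \<le> (12 * real d + 20) * iterated_log2 (Suc i) (card A) \<and>
    proper_colouring (level_vertices A d i) level_adj {..<2 ^ s} c"
proof (induction i)
  case 0
  obtain number where number: "bij_betw number A {0..<card A}"
    using ex_bij_betw_finite_nat[OF assms(1)] by blast
  define s where "s = nat \<lceil>log 2 (card A)\<rceil>"
  have "1 \<le> log 2 (card A)" using assms(2) by simp
  then have "1 \<le> s" and s_le: "real s \<le> 2 * log 2 (card A)" unfolding s_def by linarith+
  note s_le
  also have "2 * log 2 (card A) \<le> (12 * real d + 20) * iterated_log2 (Suc 0) (card A)"
    using \<open>1 \<le> log 2 (card A)\<close> by (simp add: iterated_log2_def mult_right_mono)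
  finally have "real s \<le> (12 * real d + 20) * iterated_log2 (Suc 0) (card A)" .
  moreover have "proper_colouring (level_vertices A d 0) level_adj {..<2 ^ s} (number \<circ> fst)"
  proof (rule proper_colouring_mono)
    have "card A \<le> 2 ^ s"
      unfolding s_def by (intro nat_le_two_power_if_log2_le real_nat_ceiling_ge)
    then show "{0..<card A} \<subseteq> {..<2 ^ s}" by auto
    show "proper_colouring (level_vertices A d 0) level_adj {0..<card A} (number \<circ> fst)"
      using number
      by (auto simp: proper_colouring_def level_vertices_def bij_betw_def inj_on_def subset_iff)
  qed
  ultimately show ?case using \<open>1 \<le> s\<close> by blast
next
  case (Suc i)
  then obtain s and c :: "'a \<times> ('a \<Rightarrow> nat) \<Rightarrow> nat" where s_bounds: "1 \<le> s"
    "real s \<le> (12 * real d + 20) * iterated_log2 (Suc i) (card A)"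
    and proper: "proper_colouring (level_vertices A d i) level_adj {..<2 ^ s} c"
    by blast
  have "1 \<le> iterated_log2 (Suc i) (card A)" by (simp add: iterated_log2_Suc)
  from fewer_bits_exists[OF s_bounds this] obtain s' where "1 \<le> s'"
    "real s' \<le> (12 * real d + 20) * iterated_log2 (Suc (Suc i)) (card A)"
    "2 * (8 ^ d)\<^sup>2 * s\<^sup>2 \<le> (2::nat) ^ s'"
    by (auto simp: iterated_log2_Suc)
  with level_colouring_Suc[OF assms(1) proper s_bounds(1)] show ?case by blast
qed

corollary level_colouring_exists:
  assumes "finite A" "2 \<le> card A"
  shows "\<exists>s (c :: 'a \<times> ('a \<Rightarrow> nat) \<Rightarrow> nat). s \<le> 12 * d + 20 \<and>
    proper_colouring (level_vertices A d (log_star (card A))) level_adj {..<2 ^ s} c"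
proof -
  have "iterated_log2 (Suc (log_star (card A))) (card A) = 1"
    using iterated_log2_log_star[of "card A"] assms(2) by (simp add: iterated_log2_Suc)
  then obtain s and c :: "'a \<times> ('a \<Rightarrow> nat) \<Rightarrow> nat" where "real s \<le> 12 * real d + 20"
    "proper_colouring (level_vertices A d (log_star (card A))) level_adj {..<2 ^ s} c"
    using level_colouring_iterate[OF assms, of d "log_star (card A)"] by auto
  moreover from this(1) have "s \<le> 12 * d + 20" by linarith
  ultimately show ?thesis by blast
qed

section \<open>Log-concave sequences\<close>

definition log_concave_seq :: "nat \<Rightarrow> (nat \<Rightarrow> real) \<Rightarrow> bool" where
  "log_concave_seq n f \<longleftrightarrow>
     (\<forall>k\<le>n. 0 < f k) \<and> (\<forall>k. k + 2 \<le> n \<longrightarrow> f k * f (k + 2) \<le> (f (k + 1))\<^sup>2)"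

lemma log_concave_seq_pos: "log_concave_seq n f \<Longrightarrow> k \<le> n \<Longrightarrow> 0 < f k"
  by (simp add: log_concave_seq_def)

lemma log_concave_seq_cong:
  assumes "\<And>k. k \<le> n \<Longrightarrow> f k = g k"
  shows "log_concave_seq n f \<longleftrightarrow> log_concave_seq n g"
  using assms by (simp add: log_concave_seq_def)

lemma log_concave_seq_mult:
  assumes "log_concave_seq n f" "log_concave_seq n g"
  shows "log_concave_seq n (\<lambda>k. f k * g k)"
  unfolding log_concave_seq_def
proof (intro conjI allI impI)
  show "0 < f k * g k" if "k \<le> n" for k
    using assms that by (simp add: log_concave_seq_pos)
  show "f k * g k * (f (k + 2) * g (k + 2)) \<le> (f (k + 1) * g (k + 1))\<^sup>2" if "k + 2 \<le> n" for k
  proof -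
    have "(f k * f (k + 2)) * (g k * g (k + 2)) \<le> (f (k + 1))\<^sup>2 * (g (k + 1))\<^sup>2"
      using assms that by (intro mult_mono) (auto simp: log_concave_seq_def less_imp_le)
    then show ?thesis by (simp only: mult_ac power_mult_distrib)
  qed
qed

lemma log_concave_seq_geometric:
  assumes "0 < c" "0 < q"
  shows "log_concave_seq n (\<lambda>k. c * q ^ k)"
  using assms by (simp add: log_concave_seq_def power2_eq_square mult_ac)

lemma binomial_log_concave: "(n choose k) * (n choose (k + 2)) \<le> (n choose (k + 1))\<^sup>2"
proof (cases "k < n")
  case True
  have absorb: "(k + 1) * (n choose (k + 1)) = (n - k) * (n choose k)"
    using binomial_absorb_comp[of n k] binomial_absorption[of k n] by simp
  have absorb_Suc: "(k + 2) * (n choose (k + 2)) = (n - (k + 1)) * (n choose (k + 1))"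
    using binomial_absorb_comp[of n "k + 1"] binomial_absorption[of "k + 1" n] by simp
  have "((k + 2) * (n - k)) * ((n choose k) * (n choose (k + 2)))
      = ((n - k) * (n choose k)) * ((k + 2) * (n choose (k + 2)))" by (simp only: mult_ac)
  also have "\<dots> = ((k + 1) * (n - (k + 1))) * (n choose (k + 1))\<^sup>2"
    unfolding absorb[symmetric] absorb_Suc by (simp only: mult_ac power2_eq_square)
  also have "\<dots> \<le> ((k + 2) * (n - k)) * (n choose (k + 1))\<^sup>2"
    by (intro mult_right_mono mult_mono) auto
  finally show ?thesis using True by simp
qed (simp add: binomial_eq_0)

lemma log_concave_seq_binomial: "log_concave_seq n (\<lambda>k. real (n choose k))"
  unfolding log_concave_seq_def
proof (intro conjI allI impI)
  show "real (n choose k) * real (n choose (k + 2)) \<le> (real (n choose (k + 1)))\<^sup>2" for k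
    using binomial_log_concave[of n k]
    by (simp only: of_nat_mult[symmetric] of_nat_power[symmetric] of_nat_le_iff)
qed simp

lemma log_concave_seq_shift:
  assumes "log_concave_seq n f" "a + m \<le> n"
  shows "log_concave_seq m (\<lambda>k. f (a + k))"
  using assms by (auto simp: log_concave_seq_def)

lemma log_concave_seq_reverse:
  assumes "log_concave_seq n f" "m \<le> a" "a \<le> n"
  shows "log_concave_seq m (\<lambda>k. f (a - k))"
  unfolding log_concave_seq_def
proof (intro conjI allI impI)
  show "0 < f (a - k)" if "k \<le> m" for k
    using assms by (simp add: log_concave_seq_pos)
  show "f (a - k) * f (a - (k + 2)) \<le> (f (a - (k + 1)))\<^sup>2" if "k + 2 \<le> m" for k
  proof -
    define i where "i = a - (k + 2)"
    have "a = i + (k + 2)" "i + 2 \<le> n" using that assms by (auto simp: i_def)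
    then show ?thesis using assms(1) by (simp add: log_concave_seq_def mult.commute)
  qed
qed

lemma initial_averages_mono:
  fixes \<delta> :: "nat \<Rightarrow> real"
  assumes "mono_on {..<k} \<delta>" "j \<le> k"
  shows "real k * (\<Sum>i<j. \<delta> i) \<le> real j * (\<Sum>i<k. \<delta> i)"
proof (cases "j = k")
  case False
  have "\<delta> i \<le> \<delta> i'" if "i \<le> i'" "i' < k" for i i'
    using mono_onD[OF assms(1), of i i'] that by simp
  then have head: "(\<Sum>i<j. \<delta> i) \<le> real j * \<delta> j"
    and tail: "real (k - j) * \<delta> j \<le> (\<Sum>i=j..<k. \<delta> i)"
    using sum_bounded_above[of "{..<j}" \<delta> "\<delta> j"] sum_bounded_below[of "{j..<k}" "\<delta> j" \<delta>]
      assms(2) False by auto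
  have sum_split: "(\<Sum>i<k. \<delta> i) = (\<Sum>i<j. \<delta> i) + (\<Sum>i=j..<k. \<delta> i)"
    using assms(2) by (simp add: lessThan_atLeast0 sum.atLeastLessThan_concat)
  have "real k * (\<Sum>i<j. \<delta> i) = real j * (\<Sum>i<j. \<delta> i) + real (k - j) * (\<Sum>i<j. \<delta> i)"
    using assms(2) by (simp add: of_nat_diff algebra_simps)
  also have "\<dots> \<le> real j * (\<Sum>i<j. \<delta> i) + real (k - j) * (real j * \<delta> j)"
    using head by (intro add_left_mono mult_left_mono) auto
  also have "\<dots> = real j * ((\<Sum>i<j. \<delta> i) + real (k - j) * \<delta> j)" by (simp add: algebra_simps)
  also have "\<dots> \<le> real j * (\<Sum>i<k. \<delta> i)"
    unfolding sum_split using tail by (intro mult_left_mono add_left_mono) auto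
  finally show ?thesis .
qed simp

lemma log_concave_seq_chord:
  assumes log_concave: "log_concave_seq k h" and "j \<le> k"
  shows "real k * (log 2 (h 0) - log 2 (h j)) \<le> real j * (log 2 (h 0) - log 2 (h k))"
proof -
  define \<delta> where "\<delta> i = log 2 (h i) - log 2 (h (Suc i))" for i
  have adjacent: "\<delta> i \<le> \<delta> (Suc i)" if "Suc i < k" for i
  proof -
    have pos: "0 < h i" "0 < h (i + 1)" "0 < h (i + 2)"
      using log_concave that by (auto intro: log_concave_seq_pos)
    have "log 2 (h i * h (i + 2)) \<le> log 2 ((h (i + 1))\<^sup>2)"
      using log_concave pos that by (intro log_mono) (auto simp: log_concave_seq_def)
    then show ?thesis using pos by (simp add: \<delta>_def log_mult log_nat_power)
  qed
  have "\<delta> i \<le> \<delta> i'" if "i \<le> i'" "i' < k" for i i'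
    using that by (induction i' rule: dec_induct) (auto intro: order_trans adjacent)
  then have "mono_on {..<k} \<delta>" by (auto intro: mono_onI)
  from initial_averages_mono[OF this assms(2)] show ?thesis
    unfolding \<delta>_def by (simp only: sum_lessThan_telescope'[of "\<lambda>i. log 2 (h i)"])
qed

text \<open>By concavity \<open>h j \<ge> h 0 / 2\<close> for all \<open>j \<le> k / (1 + u)\<close>.\<close>

lemma log_concave_seq_span_le:
  assumes log_concave: "log_concave_seq k h" and u_nonneg: "0 \<le> u"
    and last: "h 0 * 2 powr (- u) \<le> h k"
  shows "h 0 * real k \<le> 2 * (1 + u) * (\<Sum>j\<le>k. h j)"
proof (cases "k = 0")
  case True
  then show ?thesis using log_concave_seq_pos[OF log_concave] u_nonneg by (simp add: less_imp_le)
next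
  case False
  have pos: "0 < h j" if "j \<le> k" for j using log_concave that by (rule log_concave_seq_pos)
  define b where "b = nat \<lfloor>real k / (1 + u)\<rfloor>"
  have "log 2 (h 0 * 2 powr (- u)) \<le> log 2 (h k)" using last pos by (intro log_mono) auto
  then have drop: "log 2 (h 0) - log 2 (h k) \<le> u" using pos[of 0] by (simp add: log_mult)
  have half: "j \<le> k \<and> h 0 / 2 \<le> h j" if "j \<le> b" for j
  proof -
    have "real j \<le> real k / (1 + u)"
      using that u_nonneg unfolding b_def by (simp add: le_nat_iff le_floor_iff)
    then have "real j + real j * u \<le> real k" using u_nonneg by (simp add: field_simps)
    moreover have "0 \<le> real j * u" using u_nonneg by simp
    ultimately have "j \<le> k" by linarith
    have "real k * (log 2 (h 0) - log 2 (h j)) \<le> real j * (log 2 (h 0) - log 2 (h k))"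
      by (rule log_concave_seq_chord[OF log_concave \<open>j \<le> k\<close>])
    also have "\<dots> \<le> real j * u" using drop by (intro mult_left_mono) auto
    also have "\<dots> \<le> real k * 1" using \<open>real j + real j * u \<le> real k\<close> by simp
    finally have "log 2 (h 0) - log 2 (h j) \<le> 1" using False by simp
    then have "log 2 (h 0 / 2) \<le> log 2 (h j)" using pos[of 0] by (simp add: log_divide)
    then show ?thesis using pos[of 0] pos[OF \<open>j \<le> k\<close>] \<open>j \<le> k\<close> by simp
  qed
  have "real k / (1 + u) \<le> real b + 1" using u_nonneg unfolding b_def by linarith
  then have "real k \<le> (1 + u) * (real b + 1)"
    using u_nonneg by (simp add: pos_divide_le_eq mult.commute)
  then have "h 0 * real k \<le> h 0 * ((1 + u) * (real b + 1))"
    using pos[of 0] by (intro mult_left_mono) auto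
  also have "\<dots> = 2 * (1 + u) * (real (b + 1) * (h 0 / 2))" by (simp add: algebra_simps)
  also have "real (b + 1) * (h 0 / 2) \<le> (\<Sum>j\<le>b. h j)"
    using sum_bounded_below[of "{..b}" "h 0 / 2" h] half by simp
  also have "\<dots> \<le> (\<Sum>j\<le>k. h j)"
    using half by (intro sum_mono2) (auto intro: less_imp_le pos)
  finally show ?thesis using u_nonneg by (simp add: mult_left_mono)
qed

lemma log_concave_seq_distance_le:
  assumes log_concave: "log_concave_seq n f" and total: "(\<Sum>k\<le>n. f k) \<le> 1"
    and "a \<le> n" "k \<le> n" "0 \<le> u" "f a * 2 powr (- u) \<le> f k"
  shows "f a * \<bar>real k - real a\<bar> \<le> 2 * (1 + u)"
proof -
  have part: "2 * (1 + u) * (\<Sum>i\<le>m. f (\<sigma> i)) \<le> 2 * (1 + u) * 1"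
    if "inj_on \<sigma> {..m}" "\<sigma> ` {..m} \<subseteq> {..n}" for \<sigma> m
  proof (rule mult_left_mono)
    have "(\<Sum>i\<le>m. f (\<sigma> i)) = sum f (\<sigma> ` {..m})" using that(1) by (simp add: sum.reindex)
    also have "\<dots> \<le> (\<Sum>k\<le>n. f k)"
      using that(2) log_concave_seq_pos[OF log_concave]
      by (intro sum_mono2) (auto intro: less_imp_le)
    finally show "(\<Sum>i\<le>m. f (\<sigma> i)) \<le> 1" using total by simp
  qed (use assms(5) in simp)
  show ?thesis
  proof (cases "a \<le> k")
    case True
    then have "f (a + 0) * real (k - a) \<le> 2 * (1 + u) * (\<Sum>i\<le>k - a. f (a + i))"
      using assms by (intro log_concave_seq_span_le log_concave_seq_shift[OF log_concave]) auto
    also have "\<dots> \<le> 2 * (1 + u) * 1" using True assms(4) by (intro part) (auto simp: inj_on_def)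
    finally show ?thesis using True by (simp add: of_nat_diff)
  next
    case False
    then have "f (a - 0) * real (a - k) \<le> 2 * (1 + u) * (\<Sum>i\<le>a - k. f (a - i))"
      using assms by (intro log_concave_seq_span_le log_concave_seq_reverse[OF log_concave]) auto
    also have "\<dots> \<le> 2 * (1 + u) * 1" using False assms(3) by (intro part) (auto simp: inj_on_def)
    finally show ?thesis using False by (simp add: of_nat_diff)
  qed
qed

lemma card_log_concave_seq_level_set_le:
  assumes log_concave: "log_concave_seq n f" and total: "(\<Sum>k\<le>n. f k) \<le> 1"
    and "a \<le> n" and u_nonneg: "0 \<le> u"
  shows "real (card {k. k \<le> n \<and> f a * 2 powr (- u) \<le> f k}) \<le> 5 * (1 + u) / f a"
proof -
  define b where "b = nat \<lfloor>2 * (1 + u) / f a\<rfloor>"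
  have pos: "0 < f k" if "k \<le> n" for k using log_concave that by (rule log_concave_seq_pos)
  have "f a \<le> (\<Sum>k\<le>n. f k)" using \<open>a \<le> n\<close> pos by (intro member_le_sum) (auto intro: less_imp_le)
  then have "f a \<le> 1 + u" using total u_nonneg by simp
  have "{k. k \<le> n \<and> f a * 2 powr (- u) \<le> f k} \<subseteq> {a - b..a + b}"
  proof
    fix k assume "k \<in> {k. k \<le> n \<and> f a * 2 powr (- u) \<le> f k}"
    then have "\<bar>real k - real a\<bar> \<le> 2 * (1 + u) / f a"
      using log_concave_seq_distance_le[OF log_concave total \<open>a \<le> n\<close> _ u_nonneg] pos[OF \<open>a \<le> n\<close>]
      by (simp add: pos_le_divide_eq mult.commute)
    then have "\<bar>int k - int a\<bar> \<le> int b" unfolding b_def by linarith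
    then show "k \<in> {a - b..a + b}" by auto
  qed
  then have "card {k. k \<le> n \<and> f a * 2 powr (- u) \<le> f k} \<le> card {a - b..a + b}"
    by (intro card_mono) auto
  also have "\<dots> \<le> 2 * b + 1" by simp
  finally have "real (card {k. k \<le> n \<and> f a * 2 powr (- u) \<le> f k}) \<le> 2 * real b + 1" by linarith
  also have "\<dots> \<le> 2 * (2 * (1 + u) / f a) + (1 + u) / f a"
  proof (intro add_mono mult_left_mono)
    show "real b \<le> 2 * (1 + u) / f a" using u_nonneg pos[OF \<open>a \<le> n\<close>] by (simp add: b_def)
    show "1 \<le> (1 + u) / f a" using pos[OF \<open>a \<le> n\<close>] \<open>f a \<le> 1 + u\<close> by simp
  qed simp
  also have "\<dots> = 5 * (1 + u) / f a" by (simp add: add_divide_distrib[symmetric])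
  finally show ?thesis .
qed

section \<open>Distributions with small level sets\<close>

definition support :: "nat \<Rightarrow> (nat \<Rightarrow> real) \<Rightarrow> nat set" where
  "support N P = {m \<in> {1..N}. 0 < P m}"

definition superlevel :: "nat \<Rightarrow> (nat \<Rightarrow> real) \<Rightarrow> real \<Rightarrow> nat set" where
  "superlevel N P \<theta> = {m \<in> {1..N}. \<theta> \<le> P m}"

definition peak :: "nat \<Rightarrow> (nat \<Rightarrow> real) \<Rightarrow> real" where
  "peak N P = Max (P ` {1..N})"

text \<open>Meaningful on the support only: where \<open>P m = 0\<close> this is the junk value \<open>log 2 0 = 0\<close>.\<close>

definition depth :: "nat \<Rightarrow> (nat \<Rightarrow> real) \<Rightarrow> nat \<Rightarrow> real" where
  "depth N P m = log 2 (peak N P / P m)"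

definition small_level_sets :: "nat \<Rightarrow> (nat \<Rightarrow> real) \<Rightarrow> bool" where
  "small_level_sets N P \<longleftrightarrow>
     (\<forall>u\<ge>0. real (card (superlevel N P (peak N P * 2 powr (- u)))) \<le> 5 * (1 + u) / peak N P)"

lemma small_level_setsD:
  assumes "small_level_sets N P" "0 \<le> u"
  shows "real (card (superlevel N P (peak N P * 2 powr (- u)))) \<le> 5 * (1 + u) / peak N P"
  using assms by (simp add: small_level_sets_def)

lemma finite_support [simp]: "finite (support N P)"
  by (simp add: support_def)

lemma finite_superlevel [simp]: "finite (superlevel N P \<theta>)"
  by (simp add: superlevel_def)

lemma is_dist_le_one:
  assumes "is_dist N P" "m \<in> {1..N}"
  shows "P m \<le> 1"
proof -
  have "P m \<le> (\<Sum>m=1..N. P m)"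
    using assms by (intro member_le_sum) (auto simp: is_dist_def)
  then show ?thesis using assms(1) by (simp add: is_dist_def)
qed

lemma sum_support:
  assumes "is_dist N P"
  shows "(\<Sum>m\<in>support N P. P m * g m) = (\<Sum>m=1..N. P m * g m)"
  by (rule sum.mono_neutral_left) (use assms in \<open>auto simp: is_dist_def support_def\<close>)

lemma sum_support_eq_one:
  assumes "is_dist N P"
  shows "(\<Sum>m\<in>support N P. P m) = 1"
  using sum_support[OF assms, of "\<lambda>_. 1"] assms by (simp add: is_dist_def)

lemma le_peak: "m \<in> {1..N} \<Longrightarrow> P m \<le> peak N P"
  unfolding peak_def by (intro Max_ge) auto

lemma peak_attained:
  assumes "is_dist N P"
  obtains a where "a \<in> support N P" "P a = peak N P"
proof -
  have "support N P \<noteq> {}" using sum_support_eq_one[OF assms] by auto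
  then obtain m where m: "m \<in> {1..N}" "0 < P m" by (auto simp: support_def)
  then have "peak N P \<in> P ` {1..N}" unfolding peak_def by (intro Max_in) auto
  then obtain a where "a \<in> {1..N}" "P a = peak N P" by auto
  moreover have "0 < peak N P" using m le_peak[of m N P] by simp
  ultimately show thesis using that by (simp add: support_def)
qed

lemma
  assumes "is_dist N P"
  shows peak_pos: "0 < peak N P" and peak_le_one: "peak N P \<le> 1"
proof -
  obtain a where a: "a \<in> {1..N}" "0 < P a" "P a = peak N P"
    using peak_attained[OF assms] by (auto simp: support_def)
  then show "0 < peak N P" "peak N P \<le> 1" using is_dist_le_one[OF assms a(1)] by simp_all
qed

lemma depth_nonneg:
  assumes "m \<in> support N P"
  shows "0 \<le> depth N P m"
proof -
  have "P m \<le> peak N P" "0 < P m" using assms le_peak[of m N P] by (auto simp: support_def)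
  then show ?thesis by (simp add: depth_def zero_le_log_cancel_iff)
qed

lemma eq_peak_times_depth:
  assumes "m \<in> support N P"
  shows "P m = peak N P * 2 powr (- depth N P m)"
proof -
  have "P m \<le> peak N P" "0 < P m" using assms le_peak[of m N P] by (auto simp: support_def)
  then show ?thesis by (simp add: depth_def powr_minus)
qed

lemma inverse_peak_le_two_powr_entropy:
  assumes "is_dist N P"
  shows "1 / peak N P \<le> 2 powr entropy N P"
proof -
  have "log 2 (1 / peak N P) = (\<Sum>m\<in>support N P. P m * log 2 (1 / peak N P))"
    using sum_support_eq_one[OF assms] by (simp flip: sum_distrib_right)
  also have "\<dots> \<le> entropy N P"
    unfolding entropy_def support_def using peak_pos[OF assms] le_peak[of _ N P]
    by (intro sum_mono mult_left_mono log_mono divide_left_mono) auto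
  finally have "2 powr (log 2 (1 / peak N P)) \<le> 2 powr entropy N P" by (intro powr_mono) auto
  then show ?thesis using peak_pos[OF assms] by simp
qed

lemma small_level_sets_log_concave:
  assumes dist_P: "is_dist N P" and bij: "bij_betw \<pi> {..n} {1..N}"
    and log_concave: "log_concave_seq n (\<lambda>k. P (\<pi> k))"
  shows "small_level_sets N P"
  unfolding small_level_sets_def
proof (intro allI impI)
  fix u :: real assume u_nonneg: "0 \<le> u"
  obtain a where attained: "a \<in> support N P" "P a = peak N P" using peak_attained[OF dist_P] .
  then have "a \<in> \<pi> ` {..n}" using bij by (simp add: support_def bij_betw_def)
  then obtain b where rank: "b \<le> n" "P (\<pi> b) = peak N P" using attained(2) by auto
  have total: "(\<Sum>k\<le>n. P (\<pi> k)) \<le> 1"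
    using dist_P sum.reindex_bij_betw[OF bij, of P] by (simp add: is_dist_def)
  let ?ranks = "{k. k \<le> n \<and> P (\<pi> b) * 2 powr (- u) \<le> P (\<pi> k)}"
  have "superlevel N P (peak N P * 2 powr (- u)) \<subseteq> \<pi> ` ?ranks"
    using bij rank(2) by (auto simp: superlevel_def bij_betw_def)
  then have "card (superlevel N P (peak N P * 2 powr (- u))) \<le> card ?ranks"
    by (rule surj_card_le[rotated]) simp
  also have "real \<dots> \<le> 5 * (1 + u) / P (\<pi> b)"
    by (rule card_log_concave_seq_level_set_le[OF log_concave total rank(1) u_nonneg])
  finally show "real (card (superlevel N P (peak N P * 2 powr (- u)))) \<le> 5 * (1 + u) / peak N P"
    by (simp add: rank(2))
qed

lemma small_level_sets_Flat:
  assumes "P \<in> Flat N"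
  shows "small_level_sets N P"
  unfolding small_level_sets_def
proof (intro allI impI)
  fix u :: real assume "0 \<le> u"
  obtain S where dist_P: "is_dist N P" and "S \<subseteq> {1..N}"
    and uniform: "\<And>m. m \<in> {1..N} \<Longrightarrow> P m = (if m \<in> S then 1 / real (card S) else 0)"
    using assms unfolding Flat_def by blast
  obtain a where "a \<in> support N P" "P a = peak N P" using peak_attained[OF dist_P] by blast
  then have peak: "peak N P = 1 / real (card S)"
    using uniform by (force simp: support_def split: if_splits)
  have "0 < peak N P * 2 powr (- u)" using peak_pos[OF dist_P] by simp
  then have "superlevel N P (peak N P * 2 powr (- u)) \<subseteq> S"
    using uniform by (auto simp: superlevel_def split: if_splits)
  then have "card (superlevel N P (peak N P * 2 powr (- u))) \<le> card S"
    using \<open>S \<subseteq> {1..N}\<close> by (intro card_mono) (auto intro: finite_subset)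
  also have "real (card S) \<le> 5 * (1 + u) / peak N P"
    unfolding peak using mult_right_mono[of 1 "5 * (1 + u)" "real (card S)"] \<open>0 \<le> u\<close> by simp
  finally show "real (card (superlevel N P (peak N P * 2 powr (- u)))) \<le> 5 * (1 + u) / peak N P"
    by simp
qed

lemma small_level_sets_Geo:
  assumes "P \<in> Geo N"
  shows "small_level_sets N P"
proof -
  obtain \<alpha> \<pi> where dist_P: "is_dist N P" and \<alpha>: "0 < \<alpha>" and bij: "bij_betw \<pi> {1..N} {1..N}"
    and ratio: "\<And>k. k \<in> {1..N-1} \<Longrightarrow> P (\<pi> (k+1)) = \<alpha> * P (\<pi> k)"
    using assms by (auto simp: Geo_def)
  obtain a where "a \<in> support N P" using peak_attained[OF dist_P] by blast
  then have a: "a \<in> {1..N}" "0 < P a" by (auto simp: support_def)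
  have "bij_betw Suc {..N - 1} {1..N}"
    by (rule bij_betw_byWitness[where f' = "\<lambda>k. k - 1"]) (use a in auto)
  from bij_betw_trans[OF this bij] have shifted: "bij_betw (\<lambda>k. \<pi> (Suc k)) {..N - 1} {1..N}"
    by (simp add: o_def)
  have power: "P (\<pi> (Suc k)) = P (\<pi> 1) * \<alpha> ^ k" if "k \<le> N - 1" for k
    using that
  proof (induction k)
    case (Suc k)
    then show ?case using ratio[of "Suc k"] by simp
  qed simp
  have "a \<in> (\<lambda>k. \<pi> (Suc k)) ` {..N - 1}" using a(1) shifted by (simp add: bij_betw_def)
  then obtain k where "k \<le> N - 1" "a = \<pi> (Suc k)" by auto
  then have "0 < P (\<pi> 1)" using a(2) power[of k] \<alpha> by (simp add: zero_less_mult_iff)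
  then have "log_concave_seq (N - 1) (\<lambda>k. P (\<pi> 1) * \<alpha> ^ k)"
    using \<alpha> by (rule log_concave_seq_geometric)
  then have "log_concave_seq (N - 1) (\<lambda>k. P (\<pi> (Suc k)))"
    by (simp only: log_concave_seq_cong[OF power])
  then show ?thesis by (rule small_level_sets_log_concave[OF dist_P shifted])
qed

lemma small_level_sets_Bin:
  assumes "P \<in> Bin N"
  shows "small_level_sets N P"
proof -
  obtain p \<pi> where dist_P: "is_dist N P" and p_bounds: "0 < p" "p < 1"
    and bij: "bij_betw \<pi> {..N - 1} {1..N}"
    and binomial: "\<And>k. k \<le> N - 1 \<Longrightarrow> P (\<pi> k) = real ((N-1) choose k) * p ^ k * (1-p) ^ (N-1-k)"
    using assms by (auto simp: Bin_def atLeast0AtMost)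
  have factored: "P (\<pi> k) = real ((N-1) choose k) * ((1 - p) ^ (N - 1) * (p / (1 - p)) ^ k)"
    if "k \<le> N - 1" for k
  proof -
    have "(1 - p) ^ (N - 1 - k) = (1 - p) ^ (N - 1) / (1 - p) ^ k"
      using that p_bounds by (intro power_diff) auto
    then show ?thesis unfolding binomial[OF that] by (simp add: power_divide)
  qed
  have "log_concave_seq (N - 1)
      (\<lambda>k. real ((N-1) choose k) * ((1 - p) ^ (N - 1) * (p / (1 - p)) ^ k))"
    using p_bounds
    by (intro log_concave_seq_mult log_concave_seq_binomial log_concave_seq_geometric) auto
  then have "log_concave_seq (N - 1) (\<lambda>k. P (\<pi> k))"
    by (simp only: log_concave_seq_cong[OF factored])
  then show ?thesis by (rule small_level_sets_log_concave[OF dist_P bij])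
qed

lemma small_level_sets_Fam: "P \<in> Fam N \<Longrightarrow> small_level_sets N P"
  using small_level_sets_Flat small_level_sets_Geo small_level_sets_Bin by (auto simp: Fam_def)

lemma is_dist_Fam: "P \<in> Fam N \<Longrightarrow> is_dist N P"
  by (auto simp: Fam_def Flat_def Geo_def Bin_def)

section \<open>Expected depth\<close>

lemma sum_power_layers_le:
  fixes r :: real
  assumes finite_A: "finite A" and ratio: "0 \<le> r" "r < 1" and c_nonneg: "0 \<le> c"
    and layer: "\<And>i. real (card {x \<in> A. k x = i}) \<le> c * real (Suc i)"
  shows "(\<Sum>x\<in>A. r ^ k x) \<le> c / (1 - r)\<^sup>2"
proof -
  have sums: "(\<lambda>i. real (Suc i) * r ^ i) sums (1 / (1 - r)\<^sup>2)"
    using geometric_deriv_sums[of r] ratio by simp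
  have "(\<Sum>x\<in>A. r ^ k x) = (\<Sum>i\<in>k ` A. \<Sum>x\<in>{x \<in> A. k x = i}. r ^ k x)"
    by (rule sum.image_gen[OF finite_A])
  also have "\<dots> = (\<Sum>i\<in>k ` A. real (card {x \<in> A. k x = i}) * r ^ i)" by (intro sum.cong) auto
  also have "\<dots> \<le> (\<Sum>i\<in>k ` A. c * real (Suc i) * r ^ i)"
    using layer ratio by (intro sum_mono mult_right_mono) auto
  also have "\<dots> = c * (\<Sum>i\<in>k ` A. real (Suc i) * r ^ i)" by (simp add: sum_distrib_left mult.assoc)
  also have "\<dots> \<le> c * (\<Sum>i. real (Suc i) * r ^ i)"
    using finite_A ratio c_nonneg
    by (intro mult_left_mono sum_le_suminf sums_summable[OF sums]) auto
  also have "\<dots> = c / (1 - r)\<^sup>2" by (simp only: sums_unique[OF sums, symmetric]) simp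
  finally show ?thesis .
qed

lemma sum_two_powr_depth_le:
  assumes dist_P: "is_dist N P" and small: "small_level_sets N P"
  shows "(\<Sum>m\<in>support N P. 2 powr (- depth N P m / 2)) \<le> 60 / peak N P"
proof -
  define k where "k m = nat \<lfloor>depth N P m / 2\<rfloor>" for m
  have "real (card {m \<in> support N P. k m = i}) \<le> 15 / peak N P * real (Suc i)" for i
  proof -
    let ?u = "2 * real (Suc i)"
    have "{m \<in> support N P. k m = i} \<subseteq> superlevel N P (peak N P * 2 powr (- ?u))"
    proof
      fix m assume m: "m \<in> {m \<in> support N P. k m = i}"
      then have "depth N P m \<le> ?u" unfolding k_def by simp linarith
      then have "peak N P * 2 powr (- ?u) \<le> peak N P * 2 powr (- depth N P m)"
        using peak_pos[OF dist_P] by (intro mult_left_mono powr_mono) auto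
      then show "m \<in> superlevel N P (peak N P * 2 powr (- ?u))"
        using m eq_peak_times_depth[of m N P] by (simp add: superlevel_def support_def)
    qed
    then have "card {m \<in> support N P. k m = i} \<le> card (superlevel N P (peak N P * 2 powr (- ?u)))"
      by (intro card_mono) auto
    also have "real \<dots> \<le> 5 * (1 + ?u) / peak N P" by (rule small_level_setsD[OF small]) simp
    also have "\<dots> \<le> 5 * (3 * real (Suc i)) / peak N P"
      using peak_pos[OF dist_P] by (intro divide_right_mono) auto
    finally show ?thesis by simp
  qed
  then have "(\<Sum>m\<in>support N P. (1 / 2 :: real) ^ k m) \<le> 15 / peak N P / (1 - 1 / 2)\<^sup>2"
    using peak_pos[OF dist_P] by (intro sum_power_layers_le) auto
  moreover have "(\<Sum>m\<in>support N P. 2 powr (- depth N P m / 2)) \<le> (\<Sum>m\<in>support N P. (1 / 2) ^ k m)"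
  proof (rule sum_mono)
    fix m assume "m \<in> support N P"
    then have "0 \<le> depth N P m" by (rule depth_nonneg)
    then have "real (k m) \<le> depth N P m / 2" unfolding k_def by linarith
    then have "2 powr (- depth N P m / 2) \<le> 2 powr (- real (k m))" by (intro powr_mono) auto
    then show "2 powr (- depth N P m / 2) \<le> (1 / 2) ^ k m"
      by (simp add: powr_minus powr_realpow power_one_over inverse_eq_divide)
  qed
  ultimately show ?thesis by (simp add: power2_eq_square)
qed

lemma support_mono:
  assumes "\<And>m. m \<in> {1..N} \<Longrightarrow> P m \<le> 2 powr W * Q m"
  shows "support N P \<subseteq> support N Q"
proof
  fix m assume "m \<in> support N P"
  then have m: "m \<in> {1..N}" "0 < P m" by (auto simp: support_def)
  then have "0 < 2 powr W * Q m" using assms[of m] by simp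
  then show "m \<in> support N Q" using m(1) by (simp add: support_def zero_less_mult_iff)
qed

lemma mult_depth_le:
  assumes m_support: "m \<in> support N Q" and "0 \<le> x" and dominated: "x \<le> 2 powr W * Q m"
  shows "x * depth N Q m \<le> 2 * W * x + 4 * peak N Q * 2 powr (- depth N Q m / 2)"
proof -
  let ?M = "peak N Q" and ?t = "depth N Q m"
  have "?t / 2 - W = log 2 (2 powr (?t / 2 - W))" by simp
  also have "\<dots> \<le> 2 * 2 powr (?t / 2 - W)"
    using log2_le_linear[of "2 powr (?t / 2 - W)" 0] by simp
  finally have "?t \<le> 2 * W + 4 * 2 powr (?t / 2 - W)" by simp
  then have "x * ?t \<le> x * (2 * W + 4 * 2 powr (?t / 2 - W))"
    using \<open>0 \<le> x\<close> by (rule mult_left_mono)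
  also have "\<dots> = 2 * W * x + x * (4 * 2 powr (?t / 2 - W))" by (simp add: algebra_simps)
  also have "x * (4 * 2 powr (?t / 2 - W)) \<le>
      (2 powr W * (?M * 2 powr (- ?t))) * (4 * 2 powr (?t / 2 - W))"
    using dominated unfolding eq_peak_times_depth[OF m_support, symmetric]
    by (rule mult_right_mono) simp
  also have "\<dots> = 4 * ?M * (2 powr W * 2 powr (- ?t) * 2 powr (?t / 2 - W))"
    by (simp only: mult_ac)
  also have "2 powr W * 2 powr (- ?t) * 2 powr (?t / 2 - W) = 2 powr (- ?t / 2)"
    unfolding powr_add[symmetric] by simp
  finally show ?thesis by simp
qed

lemma expected_depth_le:
  assumes dist_P: "is_dist N P" and dist_Q: "is_dist N Q" and small: "small_level_sets N Q"
    and dominated: "\<And>m. m \<in> {1..N} \<Longrightarrow> P m \<le> 2 powr W * Q m"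
  shows "(\<Sum>m\<in>support N P. P m * depth N Q m) \<le> 2 * W + 240"
proof -
  let ?M = "peak N Q" and ?t = "depth N Q"
  have subset: "support N P \<subseteq> support N Q" using dominated by (rule support_mono)
  have pointwise: "P m * ?t m \<le> 2 * W * P m + 4 * ?M * 2 powr (- ?t m / 2)"
    if "m \<in> support N P" for m
    using that subset dominated[of m] by (intro mult_depth_le) (auto simp: support_def)
  have "(\<Sum>m\<in>support N P. P m * ?t m) \<le>
      (\<Sum>m\<in>support N P. 2 * W * P m + 4 * ?M * 2 powr (- ?t m / 2))"
    by (rule sum_mono[OF pointwise])
  also have "\<dots> = 2 * W + 4 * ?M * (\<Sum>m\<in>support N P. 2 powr (- ?t m / 2))"
    using sum_support_eq_one[OF dist_P] by (simp add: sum.distrib flip: sum_distrib_left)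
  also have "\<dots> \<le> 2 * W + 4 * ?M * (\<Sum>m\<in>support N Q. 2 powr (- ?t m / 2))"
    using subset peak_pos[OF dist_Q] by (intro add_left_mono mult_left_mono sum_mono2) auto
  also have "\<dots> \<le> 2 * W + 4 * ?M * (60 / ?M)"
    using sum_two_powr_depth_le[OF dist_Q small] peak_pos[OF dist_Q]
    by (intro add_left_mono mult_left_mono) auto
  finally show ?thesis using peak_pos[OF dist_Q] by simp
qed

section \<open>Closeness\<close>

lemma close_sym: "close N \<Delta> P Q \<Longrightarrow> close N \<Delta> Q P"
  by (auto simp: close_def)

lemma close_refl:
  assumes "0 \<le> \<Delta>" "is_dist N P"
  shows "close N \<Delta> P P"
proof -
  have "1 \<le> 2 powr \<Delta>" using assms(1) by (simp add: ge_one_powr_ge_zero)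
  then have "P m \<le> 2 powr \<Delta> * P m" if "m \<in> {1..N}" for m
    using mult_right_mono[of 1 "2 powr \<Delta>" "P m"] assms(2) that by (simp add: is_dist_def)
  then show ?thesis by (simp add: close_def)
qed

lemma le_mult_powr_trans:
  fixes x y z :: real
  assumes "x \<le> 2 powr a * y" "y \<le> 2 powr b * z"
  shows "x \<le> 2 powr (a + b) * z"
proof -
  note assms(1)
  also have "2 powr a * y \<le> 2 powr a * (2 powr b * z)"
    using assms(2) by (rule mult_left_mono) simp
  finally show ?thesis by (simp add: powr_add mult.assoc)
qed

lemma close_trans:
  assumes "close N \<Delta> P Q" "close N \<Delta>' Q R"
  shows "close N (\<Delta> + \<Delta>') P R"
  using assms le_mult_powr_trans[where a = \<Delta> and b = \<Delta>']
    le_mult_powr_trans[where a = \<Delta>' and b = \<Delta>]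
  unfolding close_def by (metis add.commute)

lemma close_mono:
  assumes "close N \<Delta> P Q" "\<Delta> \<le> \<Delta>'" "is_dist N Q"
  shows "close N \<Delta>' P Q"
  using close_trans[OF assms(1) close_refl, of "\<Delta>' - \<Delta>"] assms(2,3) by simp

lemma close_imp_support_eq:
  assumes "close N \<Delta> P Q"
  shows "support N P = support N Q"
proof -
  have "support N P \<subseteq> support N Q" if "close N \<Delta> P Q" for P Q
    using that by (intro support_mono) (auto simp: close_def)
  from this[OF assms] this[OF close_sym[OF assms]] show ?thesis by (rule subset_antisym)
qed

lemma close_abs_log_diff_le:
  assumes "close N \<Delta> P Q" "m \<in> support N P"
  shows "\<bar>log 2 (1 / P m) - log 2 (1 / Q m)\<bar> \<le> \<Delta>"
proof -
  have "m \<in> {1..N}" and pos: "0 < P m" "0 < Q m"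
    using assms close_imp_support_eq[OF assms(1)] by (auto simp: support_def)
  then have "P m \<le> 2 powr \<Delta> * Q m" "Q m \<le> 2 powr \<Delta> * P m"
    using assms(1) by (auto simp: close_def)
  then have "log 2 (P m) \<le> log 2 (2 powr \<Delta> * Q m)" "log 2 (Q m) \<le> log 2 (2 powr \<Delta> * P m)"
    using pos by (auto intro: log_mono)
  then show ?thesis using pos by (simp add: log_mult log_divide abs_le_iff)
qed

lemma close_imp_superlevel_subset:
  assumes "close N \<Delta> P Q"
  shows "superlevel N P \<theta> \<subseteq> superlevel N Q (2 powr (- \<Delta>) * \<theta>)"
proof
  fix m assume "m \<in> superlevel N P \<theta>"
  then have m: "m \<in> {1..N}" and "\<theta> \<le> P m" by (auto simp: superlevel_def)
  moreover have "P m \<le> 2 powr \<Delta> * Q m" using assms m by (simp add: close_def)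
  ultimately have "\<theta> \<le> 2 powr \<Delta> * Q m" by linarith
  then have "2 powr (- \<Delta>) * \<theta> \<le> Q m" by (simp add: powr_minus field_simps)
  with m show "m \<in> superlevel N Q (2 powr (- \<Delta>) * \<theta>)" by (simp add: superlevel_def)
qed

section \<open>The coding scheme\<close>

definition unary :: "nat \<Rightarrow> bool list" where
  "unary n = replicate n True @ [False]"

lemma length_unary [simp]: "length (unary n) = Suc n"
  by (simp add: unary_def)

lemma unary_append_inject: "unary j @ xs = unary k @ ys \<longleftrightarrow> j = k \<and> xs = ys"
proof (induction j arbitrary: k)
  case 0
  show ?case by (cases k) (auto simp: unary_def)
next
  case (Suc j)
  then show ?case by (cases k) (auto simp: unary_def)
qed

lemma unary_inject: "unary j = unary k \<longleftrightarrow> j = k"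
  using unary_append_inject[of j "[]" k "[]"] by simp

definition binary :: "nat \<Rightarrow> nat \<Rightarrow> bool list" where
  "binary s n = map (bit n) [0..<s]"

lemma length_binary [simp]: "length (binary s n) = s"
  by (simp add: binary_def)

lemma binary_inject:
  assumes "m < 2 ^ s" "n < 2 ^ s" "binary s m = binary s n"
  shows "m = n"
  using arg_cong[OF assms(3), of "horner_sum of_bool (2::nat)"] assms(1,2)
  by (simp add: binary_def horner_sum_bit_eq_take_bit take_bit_nat_eq_self)

definition local_cost :: "nat \<Rightarrow> real \<Rightarrow> (nat \<Rightarrow> real) \<Rightarrow> nat \<Rightarrow> real" where
  "local_cost N W P m =
     log 2 (1 / P m) / W + 24 + 13 * real (card (superlevel N P (P m * 2 powr (- 3 * W))))"

locale level_code =
  fixes N K :: nat and \<Delta> W :: real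
    and width :: "nat \<Rightarrow> nat" and colour :: "nat \<Rightarrow> nat \<times> (nat \<Rightarrow> nat) \<Rightarrow> nat"
  assumes \<Delta>_pos: "0 < \<Delta>" and W_pos: "0 < W" and \<Delta>_K_le: "\<Delta> * real K \<le> W"
    and width_le: "width d \<le> 12 * d + 20"
    and colouring:
      "proper_colouring (level_vertices {1..N} d K) level_adj {..<2 ^ width d} (colour d)"
begin

definition shell :: "(nat \<Rightarrow> real) \<Rightarrow> nat \<Rightarrow> nat" where
  "shell P m = nat \<lceil>log 2 (1 / P m) / W\<rceil>"

definition level :: "(nat \<Rightarrow> real) \<Rightarrow> nat \<Rightarrow> nat \<Rightarrow> nat" where
  "level P j x =
     (if x \<in> support N P then nat \<lceil>(log 2 (1 / P x) - W * real j) / (2 * \<Delta>)\<rceil> else Suc K)"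

definition ball_size :: "(nat \<Rightarrow> real) \<Rightarrow> nat \<Rightarrow> nat" where
  "ball_size P j = card {x. level P j x \<le> K}"

definition payload :: "(nat \<Rightarrow> real) \<Rightarrow> nat \<Rightarrow> nat \<Rightarrow> bool list" where
  "payload P j m = unary j @ unary (ball_size P j) @
     binary (width (ball_size P j)) (colour (ball_size P j) (m, level P j))"

definition encode :: "(nat \<Rightarrow> real) \<Rightarrow> nat \<Rightarrow> bool list" where
  "encode P m = (if m \<in> support N P then True # payload P (shell P m) m else False # unary m)"

lemma shell_bounds:
  assumes "is_dist N P" "m \<in> support N P"
  shows "log 2 (1 / P m) \<le> W * real (shell P m)"
    and "real (shell P m) \<le> log 2 (1 / P m) / W + 1"
proof -
  have "P m \<le> 1" "0 < P m" using assms is_dist_le_one by (auto simp: support_def)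
  then have "0 \<le> log 2 (1 / P m)" by (simp add: log_divide)
  then have "0 \<le> log 2 (1 / P m) / W" using W_pos by simp
  then show "real (shell P m) \<le> log 2 (1 / P m) / W + 1" unfolding shell_def by linarith
  have "log 2 (1 / P m) / W \<le> real (shell P m)" unfolding shell_def by (rule real_nat_ceiling_ge)
  then show "log 2 (1 / P m) \<le> W * real (shell P m)" using W_pos by (simp add: field_simps)
qed

lemma levels_close_level:
  assumes "close N (2 * \<Delta>) P P'"
  shows "levels_close (level P j) (level P' j)"
  unfolding levels_close_def
proof
  fix x
  show "level P j x \<le> level P' j x + 1 \<and> level P' j x \<le> level P j x + 1"
  proof (cases "x \<in> support N P")
    case True
    let ?a = "(log 2 (1 / P x) - W * real j) / (2 * \<Delta>)"
    let ?b = "(log 2 (1 / P' x) - W * real j) / (2 * \<Delta>)"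
    have "?a - ?b = (log 2 (1 / P x) - log 2 (1 / P' x)) / (2 * \<Delta>)"
      by (simp add: diff_divide_distrib)
    then have "\<bar>?a - ?b\<bar> \<le> 1"
      using close_abs_log_diff_le[OF assms True] \<Delta>_pos by (simp add: abs_divide)
    then have "nat \<lceil>?a\<rceil> \<le> nat \<lceil>?b\<rceil> + 1 \<and> nat \<lceil>?b\<rceil> \<le> nat \<lceil>?a\<rceil> + 1" by linarith
    then show ?thesis using True close_imp_support_eq[OF assms] by (simp add: level_def)
  next
    case False
    then show ?thesis using close_imp_support_eq[OF assms] by (simp add: level_def)
  qed
qed

lemma level_shell_in_level_vertices:
  assumes "m \<in> support N P" "is_dist N P"
  shows "(m, level P (shell P m)) \<in> level_vertices {1..N} (ball_size P (shell P m)) K"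
proof -
  have "(log 2 (1 / P m) - W * real (shell P m)) / (2 * \<Delta>) \<le> 0"
    using shell_bounds(1)[OF assms(2,1)] \<Delta>_pos by (intro divide_nonpos_pos) auto
  then have "level P (shell P m) m = 0" using assms(1) by (simp add: level_def)
  moreover have "{x. level P (shell P m) x \<le> K} \<subseteq> {1..N}"
    by (auto simp: level_def support_def split: if_splits)
  ultimately show ?thesis by (simp add: level_vertices_def ball_size_def)
qed

lemma encode_inject:
  assumes "is_dist N P" "is_dist N P'" and close: "close N (2 * \<Delta>) P P'"
    and eq: "encode P m = encode P' m'"
  shows "m = m'"
proof (cases "m \<in> support N P")
  case False
  then show ?thesis using eq by (auto simp: encode_def unary_inject split: if_splits)
next
  case True
  then have m': "m' \<in> support N P'" using eq by (auto simp: encode_def split: if_splits)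
  define j d where "j = shell P m" and "d = ball_size P j"
  have "shell P' m' = j" "ball_size P' j = d"
    and word: "binary (width d) (colour d (m, level P j)) =
      binary (width d) (colour d (m', level P' j))"
    using eq True m' by (auto simp: encode_def payload_def unary_append_inject j_def d_def)
  then have vertices: "(m, level P j) \<in> level_vertices {1..N} d K"
      "(m', level P' j) \<in> level_vertices {1..N} d K"
    using level_shell_in_level_vertices[OF True assms(1)]
      level_shell_in_level_vertices[OF m' assms(2)]
    by (auto simp: j_def d_def)
  then have "colour d (m, level P j) = colour d (m', level P' j)"
    using binary_inject[OF _ _ word] colouring[of d] by (auto simp: proper_colouring_def Pi_iff)
  then have "\<not> level_adj (m, level P j) (m', level P' j)"
    using colouring[of d] vertices unfolding proper_colouring_def by blast
  then show ?thesis using levels_close_level[OF close] by simp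
qed

lemma ball_size_le:
  assumes dist_P: "is_dist N P" and m_support: "m \<in> support N P"
  shows "ball_size P (shell P m) \<le> card (superlevel N P (P m * 2 powr (- 3 * W)))"
  unfolding ball_size_def
proof (rule card_mono)
  show "{x. level P (shell P m) x \<le> K} \<subseteq> superlevel N P (P m * 2 powr (- 3 * W))"
  proof
    fix x assume near: "x \<in> {x. level P (shell P m) x \<le> K}"
    then have x: "x \<in> support N P" by (auto simp: level_def split: if_splits)
    then have pos: "0 < P x" "0 < P m" using m_support by (auto simp: support_def)
    have "(log 2 (1 / P x) - W * real (shell P m)) / (2 * \<Delta>) \<le> real K"
      using near x by (simp add: level_def)
    then have "log 2 (1 / P x) \<le> W * real (shell P m) + 2 * (\<Delta> * real K)"
      using \<Delta>_pos by (simp add: pos_divide_le_eq algebra_simps)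
    also have "\<dots> \<le> log 2 (1 / P m) + 3 * W"
      using mult_left_mono[OF shell_bounds(2)[OF dist_P m_support], of W] W_pos \<Delta>_K_le
      by (simp add: distrib_left)
    finally have "log 2 (P m * 2 powr (- 3 * W)) \<le> log 2 (P x)"
      using pos by (simp add: log_mult log_divide)
    then have "P m * 2 powr (- 3 * W) \<le> P x" using pos by (subst (asm) log_le_cancel_iff) auto
    then show "x \<in> superlevel N P (P m * 2 powr (- 3 * W))"
      using x by (simp add: superlevel_def support_def)
  qed
qed simp

lemma length_encode_le:
  assumes "is_dist N P" "m \<in> support N P"
  shows "real (length (encode P m)) \<le> local_cost N W P m"
proof -
  let ?d = "ball_size P (shell P m)"
  have "length (encode P m) = shell P m + ?d + 3 + width ?d"
    using assms(2) by (simp add: encode_def payload_def)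
  also have "\<dots> \<le> shell P m + 13 * ?d + 23" using width_le[of ?d] by simp
  finally show ?thesis
    using shell_bounds(2)[OF assms] ball_size_le[OF assms] unfolding local_cost_def by linarith
qed

end

lemma decoder_exists:
  assumes "1 \<le> N"
    and inj: "\<And>P P' m m'. \<lbrakk>is_dist N P; is_dist N P'; close N (2 * \<Delta>) P P'; E P m = E P' m'\<rbrakk>
      \<Longrightarrow> m = m'"
  shows "\<exists>D. (\<forall>Q w. D Q w \<in> {1..N}) \<and>
    (\<forall>P Q m. is_dist N P \<and> close N \<Delta> P Q \<and> m \<in> {1..N} \<longrightarrow> D Q (E P m) = m)"
proof -
  have "\<exists>n\<in>{1..N}. \<forall>P. \<forall>m\<in>{1..N}. is_dist N P \<and> close N \<Delta> P Q \<and> E P m = w \<longrightarrow> n = m" for Q w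
  proof (cases "\<exists>P. \<exists>m\<in>{1..N}. is_dist N P \<and> close N \<Delta> P Q \<and> E P m = w")
    case True
    then obtain P n where "n \<in> {1..N}" "is_dist N P" "close N \<Delta> P Q" "E P n = w" by blast
    moreover have "n = m" if "is_dist N P'" "close N \<Delta> P' Q" "E P' m = w" for P' m
      using inj[of P P' n m] close_trans[of N \<Delta> P Q \<Delta> P'] close_sym[of N \<Delta> P' Q] that calculation
      by simp
    ultimately show ?thesis by blast
  next
    case False
    then show ?thesis using assms(1) by (intro bexI[of _ 1]) auto
  qed
  then obtain D where "\<And>Q w. D Q w \<in> {1..N} \<and>
      (\<forall>P. \<forall>m\<in>{1..N}. is_dist N P \<and> close N \<Delta> P Q \<and> E P m = w \<longrightarrow> D Q w = m)"
    by metis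
  then show ?thesis by blast
qed

lemma zero_error_scheme_exists:
  assumes "2 \<le> N" "0 < \<Delta>" "0 < W" "\<Delta> * real (log_star N) \<le> W"
  shows "\<exists>(E :: (nat \<Rightarrow> real) \<Rightarrow> nat \<Rightarrow> bool list) D. (\<forall>Q w. D Q w \<in> {1..N}) \<and>
    (\<forall>P Q m. is_dist N P \<and> close N \<Delta> P Q \<and> m \<in> {1..N} \<longrightarrow> D Q (E P m) = m) \<and>
    (\<forall>P. \<forall>m\<in>support N P. is_dist N P \<longrightarrow> real (length (E P m)) \<le> local_cost N W P m)"
proof -
  have "\<forall>d. \<exists>s (c :: nat \<times> (nat \<Rightarrow> nat) \<Rightarrow> nat). s \<le> 12 * d + 20 \<and>
      proper_colouring (level_vertices {1..N} d (log_star N)) level_adj {..<2 ^ s} c"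
    using level_colouring_exists[of "{1..N}"] assms(1) by simp
  then obtain width and colour :: "nat \<Rightarrow> nat \<times> (nat \<Rightarrow> nat) \<Rightarrow> nat"
    where "\<And>d. width d \<le> 12 * d + 20"
      "\<And>d. proper_colouring (level_vertices {1..N} d (log_star N)) level_adj
             {..<2 ^ width d} (colour d)"
    by metis
  then interpret level_code N "log_star N" \<Delta> W width colour
    using assms by unfold_locales auto
  obtain D where "\<forall>Q w. D Q w \<in> {1..N}"
    "\<forall>P Q m. is_dist N P \<and> close N \<Delta> P Q \<and> m \<in> {1..N} \<longrightarrow> D Q (encode P m) = m"
    using decoder_exists[of N \<Delta> encode] encode_inject assms(1) by auto
  then show ?thesis using length_encode_le by blast
qed

section \<open>Expected length\<close>

lemma card_superlevel_close_le:
  assumes close: "close N W P Q" and small: "small_level_sets N Q"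
    and m_support: "m \<in> support N P" and W_nonneg: "0 \<le> W"
  shows "real (card (superlevel N P (P m * 2 powr (- 3 * W))))
    \<le> 5 * (1 + (depth N Q m + 5 * W)) / peak N Q"
proof -
  have m_support_Q: "m \<in> support N Q" using m_support close_imp_support_eq[OF close] by simp
  have "Q m \<le> 2 powr W * P m" using close m_support by (simp add: close_def support_def)
  then have "2 powr (- W) * Q m \<le> P m" by (simp add: powr_minus field_simps)
  have "peak N Q * 2 powr (- (depth N Q m + 5 * W)) = 2 powr (- 4 * W) * (2 powr (- W) * Q m)"
    by (subst eq_peak_times_depth[OF m_support_Q])
      (simp add: mult.left_commute algebra_simps flip: powr_add)
  also have "\<dots> \<le> 2 powr (- 4 * W) * P m"
    using \<open>2 powr (- W) * Q m \<le> P m\<close> by (rule mult_left_mono) simp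
  also have "\<dots> = 2 powr (- W) * (P m * 2 powr (- 3 * W))"
    by (simp add: mult.left_commute flip: powr_add)
  finally have "superlevel N Q (2 powr (- W) * (P m * 2 powr (- 3 * W)))
      \<subseteq> superlevel N Q (peak N Q * 2 powr (- (depth N Q m + 5 * W)))"
    unfolding superlevel_def using order_trans by blast
  with close_imp_superlevel_subset[OF close] have "card (superlevel N P (P m * 2 powr (- 3 * W)))
      \<le> card (superlevel N Q (peak N Q * 2 powr (- (depth N Q m + 5 * W))))"
    by (intro card_mono) (auto intro: subset_trans)
  also have "real \<dots> \<le> 5 * (1 + (depth N Q m + 5 * W)) / peak N Q"
    using depth_nonneg[OF m_support_Q] W_nonneg by (intro small_level_setsD[OF small]) auto
  finally show ?thesis by simp
qed

lemma local_cost_le: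
  assumes close: "close N W P Q" and dist_Q: "is_dist N Q" and small: "small_level_sets N Q"
    and m_support: "m \<in> support N P" and W_ge_one: "1 \<le> W"
  shows "local_cost N W P m \<le> (417 * W + 66 * depth N Q m) / peak N Q"
proof -
  let ?M = "peak N Q" and ?t = "depth N Q m"
  have peak_bounds: "0 < ?M" "?M \<le> 1" using peak_pos peak_le_one dist_Q by blast+
  have "m \<in> support N Q" using m_support close_imp_support_eq[OF close] by simp
  then have "0 \<le> ?t" "0 < Q m" using depth_nonneg by (auto simp: support_def)
  have "log 2 (1 / P m) \<le> log 2 (1 / Q m) + W"
    using close_abs_log_diff_le[OF close m_support] by simp
  also have "log 2 (1 / Q m) = log 2 (1 / ?M) + ?t"
    using \<open>0 < Q m\<close> peak_bounds(1) by (simp add: depth_def log_divide)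
  also have "log 2 (1 / ?M) \<le> 2 / ?M" using log2_le_linear[of "1 / ?M" 0] peak_bounds(1) by simp
  finally have "log 2 (1 / P m) / W \<le> (2 / ?M + ?t + W) / W"
    using W_ge_one by (intro divide_right_mono) auto
  also have "\<dots> = (2 / ?M + ?t) / W + 1" using W_ge_one by (simp add: add_divide_distrib)
  also have "\<dots> \<le> 2 / ?M + ?t + 1"
    using W_ge_one peak_bounds(1) \<open>0 \<le> ?t\<close> divide_left_mono[of 1 W "2 / ?M + ?t"] by simp
  finally have shell: "log 2 (1 / P m) / W \<le> 2 / ?M + ?t + 1" .
  have "?t + 25 \<le> (?t + 25) / ?M"
    using peak_bounds \<open>0 \<le> ?t\<close> mult_left_le[of ?M "?t + 25"] by (simp add: pos_le_divide_eq)
  have "local_cost N W P m \<le> (2 / ?M + ?t + 1) + 24 + 13 * (5 * (1 + (?t + 5 * W)) / ?M)"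
    unfolding local_cost_def using W_ge_one
    by (intro add_mono mult_left_mono shell order_refl
      card_superlevel_close_le[OF close small m_support]) auto
  also have "\<dots> \<le> 2 / ?M + (?t + 25) / ?M + 13 * (5 * (1 + (?t + 5 * W)) / ?M)"
    using \<open>?t + 25 \<le> (?t + 25) / ?M\<close> by simp
  also have "\<dots> = (92 + 325 * W + 66 * ?t) / ?M" by (simp add: add_divide_distrib)
  also have "\<dots> \<le> (417 * W + 66 * ?t) / ?M"
    using W_ge_one peak_bounds(1) by (intro divide_right_mono) auto
  finally show ?thesis .
qed

lemma exp_len_le:
  assumes dist_P: "is_dist N P" and dist_Q: "is_dist N Q" and small: "small_level_sets N Q"
    and close: "close N W P Q" and W_ge_one: "1 \<le> W"
    and len: "\<And>m. m \<in> support N P \<Longrightarrow> real (length (code m)) \<le> local_cost N W P m"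
  shows "exp_len N P code \<le> 16389 * W / peak N Q"
proof -
  let ?S = "support N P" and ?M = "peak N Q" and ?t = "depth N Q"
  have "0 < ?M" using dist_Q by (rule peak_pos)
  have "exp_len N P code = (\<Sum>m\<in>?S. P m * real (length (code m)))"
    unfolding exp_len_def by (rule sum_support[OF dist_P, symmetric])
  also have "\<dots> \<le> (\<Sum>m\<in>?S. P m * ((417 * W + 66 * ?t m) / ?M))"
    using order_trans[OF len local_cost_le[OF close dist_Q small _ W_ge_one]]
    by (intro sum_mono mult_left_mono) (auto simp: support_def)
  also have "\<dots> = (\<Sum>m\<in>?S. 417 * W / ?M * P m + 66 / ?M * (P m * ?t m))"
    by (intro sum.cong) (simp_all add: add_divide_distrib algebra_simps)
  also have "\<dots> = 417 * W / ?M + 66 / ?M * (\<Sum>m\<in>?S. P m * ?t m)"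
    using sum_support_eq_one[OF dist_P]
    by (simp only: sum.distrib sum_distrib_left[symmetric] mult_1_right)
  also have "\<dots> \<le> 417 * W / ?M + 66 / ?M * (2 * W + 240)"
    using expected_depth_le[OF dist_P dist_Q small, of W] close W_ge_one \<open>0 < ?M\<close>
    by (intro add_left_mono mult_left_mono) (auto simp: close_def)
  also have "\<dots> = (549 * W + 15840) / ?M" by (simp add: add_divide_distrib distrib_left)
  also have "\<dots> \<le> 16389 * W / ?M" using W_ge_one \<open>0 < ?M\<close> by (intro divide_right_mono) auto
  finally show ?thesis .
qed

lemma universal_scheme_exists:
  assumes "2 \<le> N" "0 < \<Delta>"
  defines "W \<equiv> real_of_int \<lceil>\<Delta> * real (log_star N)\<rceil>"
  shows "\<exists>(E :: (nat \<Rightarrow> real) \<Rightarrow> nat \<Rightarrow> bool list) D. (\<forall>Q w. D Q w \<in> {1..N}) \<and>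
    (\<forall>P Q m. is_dist N P \<and> close N \<Delta> P Q \<and> m \<in> {1..N} \<longrightarrow> D Q (E P m) = m) \<and>
    (\<forall>P Q. is_dist N P \<and> Q \<in> Fam N \<and> close N (\<Delta> * real (log_star N)) P Q
       \<longrightarrow> exp_len N P (E P) \<le> 16389 * 2 powr entropy N Q * W)"
proof -
  have "0 < \<Delta> * real (log_star N)" using assms(2) log_star_pos[OF assms(1)] by simp
  then have W_bounds: "1 \<le> W" "0 < W" "\<Delta> * real (log_star N) \<le> W" by (simp_all add: W_def)
  obtain E :: "(nat \<Rightarrow> real) \<Rightarrow> nat \<Rightarrow> bool list" and D where
    scheme: "\<forall>Q w. D Q w \<in> {1..N}"
      "\<forall>P Q m. is_dist N P \<and> close N \<Delta> P Q \<and> m \<in> {1..N} \<longrightarrow> D Q (E P m) = m"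
    and len: "\<forall>P. \<forall>m\<in>support N P. is_dist N P \<longrightarrow> real (length (E P m)) \<le> local_cost N W P m"
    using zero_error_scheme_exists[OF assms(1,2) W_bounds(2,3)] by blast
  have "exp_len N P (E P) \<le> 16389 * 2 powr entropy N Q * W"
    if dist_P: "is_dist N P" and Fam_Q: "Q \<in> Fam N"
      and close: "close N (\<Delta> * real (log_star N)) P Q" for P Q
  proof -
    have "close N W P Q" by (rule close_mono[OF close W_bounds(3) is_dist_Fam[OF Fam_Q]])
    then have "exp_len N P (E P) \<le> 16389 * W / peak N Q"
      using exp_len_le[OF dist_P is_dist_Fam small_level_sets_Fam] Fam_Q W_bounds(1) len dist_P
      by blast
    also have "\<dots> = 16389 * W * (1 / peak N Q)" by simp
    also have "\<dots> \<le> 16389 * W * 2 powr entropy N Q"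
      using inverse_peak_le_two_powr_entropy[OF is_dist_Fam[OF Fam_Q]] W_bounds(2)
      by (intro mult_left_mono) auto
    finally show ?thesis by (simp only: mult_ac)
  qed
  with scheme show ?thesis by blast
qed

theorem mainTheorem14:
  shows "\<exists>C::real. \<forall>N::nat. N \<ge> 2 \<longrightarrow> (\<forall>\<Delta>::real. \<Delta> > 0 \<longrightarrow>
    (\<exists>(E :: (nat \<Rightarrow> real) \<Rightarrow> nat \<Rightarrow> bool list) (D :: (nat \<Rightarrow> real) \<Rightarrow> bool list \<Rightarrow> nat).
       (\<forall>Q w. is_dist N Q \<longrightarrow> D Q w \<in> {1..N}) \<and>
       (\<forall>P Q m. is_dist N P \<and> is_dist N Q \<and> close N \<Delta> P Q \<and> m \<in> {1..N}
            \<longrightarrow> D Q (E P m) = m) \<and>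
       (\<forall>P\<in>Fam N. exp_len N P (E P)
            \<le> C * 2 powr (entropy N P) * real_of_int \<lceil>\<Delta> * real (log_star N)\<rceil>) \<and>
       (\<forall>P Pt. is_dist N P \<and> Pt \<in> Fam N \<and> close N (\<Delta> * real (log_star N)) P Pt
            \<longrightarrow> exp_len N P (E P)
                 \<le> C * 2 powr (entropy N Pt) * real_of_int \<lceil>\<Delta> * real (log_star N)\<rceil>)))"
proof (intro exI[of _ 16389] allI impI, goal_cases scheme)
  case (scheme N \<Delta>)
  then have "close N (\<Delta> * real (log_star N)) P P" if "P \<in> Fam N" for P
    using close_refl[of "\<Delta> * real (log_star N)"] is_dist_Fam[OF that] by simp
  moreover obtain E :: "(nat \<Rightarrow> real) \<Rightarrow> nat \<Rightarrow> bool list" and D where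
    "\<forall>Q w. D Q w \<in> {1..N}"
    "\<forall>P Q m. is_dist N P \<and> close N \<Delta> P Q \<and> m \<in> {1..N} \<longrightarrow> D Q (E P m) = m"
    "\<forall>P Q. is_dist N P \<and> Q \<in> Fam N \<and> close N (\<Delta> * real (log_star N)) P Q \<longrightarrow>
       exp_len N P (E P) \<le> 16389 * 2 powr entropy N Q * real_of_int \<lceil>\<Delta> * real (log_star N)\<rceil>"
    using universal_scheme_exists[OF scheme] by blast
  ultimately show ?case using is_dist_Fam by (intro exI[of _ E] exI[of _ D]) blast
qed

end
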